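(* Let $B$ be a $C_{n,\beta}^{k,\alpha}$-presheaf in a proper full intersection structure presheaf $\mathbb{X}$. Suppose that, in $\mathbb{X}$, $B$ is ordered, fully left-absorbing (resp. fully right-absorbing) and has retractible $(B,k,\alpha,\beta)$-diffeomorphisms. Then the choice of a retraction presheaf $\overline{r}$ induces a left adjoint (resp. right adjoint) for the forgetful functor $F:\mathbf{Diff}_{\alpha,\beta}^{B,k}(\mathbb{X})\to\mathbf{Diff}^{k}$ from $(B_{\alpha,\beta}^{k},\mathbb{X})$-manifolds to $C^{k}$-manifolds, and this adjoint is independent of $\overline{r}$ (up to natural isomorphism). In particular, if $B$ is fully absorbing, then $F$ is ambidextrous adjoint.
   Context: Fix $0\le k\le\infty$, $n\ge 0$, a set $\Gamma$ with $\Gamma\cap\mathbb{Z}_{\geq0}\neq\varnothing$, put $\Lambda=\Gamma\cap\mathbb{Z}_{\geq0}$, and fix functions $\alpha:\Lambda\to\Lambda$ and $\beta:\Lambda\to[0,k]$ (integer valued). **Spaces.** A $\Lambda$-space is a family $E=(E_i)_{i\in\Lambda}$ of nuclear Fréchet spaces. A morphism $E\to E'$ is a pair $(\xi,\mu)$ with $\mu:\Lambda\to\Lambda$ a function and $\xi_i:E_i\to E'_{\mu(i)}$ continuous linear maps. The category is $\mathbf{NFre}_\Lambda$; $\mathbf{NFre}_{\Lambda\times\Lambda}$ is defined in the same way. A multiplicative structure $( *,\epsilon)$ on $E$ is a map $\epsilon:\Lambda\times\Lambda\to\Lambda$ with continuous linear maps $*_{ij}:E_i\otimes E_j\to E_{\epsilon(i,j)}$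 (projective tensor product). A distributive $\Lambda$-space is a $\Lambda$-space with two multiplicative structures $( *,\epsilon)$, $(+,\delta)$ satisfying $\epsilon(i,\delta(j,l))=\delta(\epsilon(i,j),\epsilon(i,l))$, $x*(y+z)=(x*y)+(x*z)$, and the analogous right-hand identities. (One is mainly interested in $+$ additive: $\delta(i,i)=i$ and $+_{ii}$ the addition of $E_i$.) Let $\mathbf{B}_n$ and $\mathbf{B}_{n,*,+}$ be the categories of presheaves on $\mathbb{R}^n$ of $\Lambda$-spaces and of distributive $\Lambda$-spaces (with morphisms preserving both structures). For $B\in\mathbf{B}_{n,*,+}$, $B_\alpha(U)_i=B(U)_{\alpha(i)}$, with the operations $*_{\alpha(i)\alpha(j)}$ and $+_{\alpha(i)\alpha(j)}$ of $B$. Also $C^{k-\beta}(U)_i=C^{k-\beta(i)}(U)$ (real functions, usual Fréchet topology), with pointwise sum and product, taking values for indices $(i,j)$ in $C^{k-\max(\beta(i),\beta(j))}(U)$. **Intersection structures.** A full ambient $(\mathbf{X},\gamma,\gamma_\Sigma)$ is a category $\mathbf{X}$ with pullbacks and embeddings $\gamma:\mathbf{NFre}_\Lambda\hookrightarrow\mathbf{X}$, $\gamma_\Sigma:\mathbf{NFre}_{\Lambda\times\Lambda}\hookrightarrow\mathbf{X}$. A full intersection structure presheaf (full ISP) $\mathbb{X}$ between $B_\alpha$ and $C^{k-\beta}$ consists of a full ambient, presheaves $X,X_*,X_+$ on $\mathbb{R}^n$ with values in $\mathbf{X}$, and objectwise monic natural transformations $\iota:\gamma\circ B_\alpha\Rightarrow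 X$, $\iota':\gamma\circ C^{k-\beta}\Rightarrow X$, and $\jmath_*,\jmath'_*$ into $X_*$ from $\gamma_\Sigma$ of the target families $(B_{\epsilon(\alpha(i),\alpha(j))})_{(i,j)}$ and $(C^{k-\max(\beta(i),\beta(j))})_{(i,j)}$ of the two multiplications, and likewise $\jmath_+,\jmath'_+$ into $X_+$ for the targets of the two additions. Let $\operatorname{pb}( * )$ be the objectwise pullback of $\jmath_*\circ\gamma_\Sigma( * )$ and $\jmath'_*\circ\gamma_\Sigma(\cdot)$, and $\operatorname{pb}(+)$ the analogous one for the additions. $\mathbb{X}$ is proper if the objectwise pullback of $(\iota,\iota')$ is naturally isomorphic to $\gamma\circ(B_\alpha\cap_XC^{k-\beta})$ for some $B_\alpha\cap_XC^{k-\beta}\in\mathbf{B}_n$, with its projections induced by morphisms $u,u'$ to $B_\alpha$ and $C^{k-\beta}$, and the pullbacks of $(\jmath_*,\jmath'_* )$, $(\jmath_+,\jmath'_+)$ and $\operatorname{pb}( * )$, $\operatorname{pb}(+)$ are likewise isomorphic to $\gamma_\Sigma$ of presheaves of $(\Lambda\times\Lambda)$-spaces of the form $(L_{\epsilon''(i,j)})_{(i,j)}$, for presheaves $L$ of $\Lambda$-spaces equipped with maps $\epsilon'':\Lambda\times\Lambda\to\Lambda$. The component $(B_\alpha\cap_XC^{k-\beta})(U)_i$ is written $B_{\alpha(i)}(U)\cap_{X(U)}C^{k-\beta(i)}(U)$ and is regarded, via $u'$, as a space of $C^{k-\beta(i)}$-functions on $U$. **$C_{n,\beta}^{k,\alpha}$-presheaves.**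 $B\in\mathbf{B}_{n,*,+}$ is a $C_{n,\beta}^{k,\alpha}$-presheaf in a proper full ISP $\mathbb{X}$ if: (i) $B_\alpha\cap_XC^{k-\beta}$, $\operatorname{pb}( * )$ and $\operatorname{pb}(+)$ have positive real dimension on every open $U$; (ii) there are $A\in\mathbf{B}_n$, an objectwise monic $A\Rightarrow C^k$ (where $C^k(U)_i=C^k(U)$), and an action $\star:A\otimes(B_\alpha\cap_XC^{k-\beta})\Rightarrow B_\alpha\cap_XC^{k-\beta}$ (componentwise tensor product) which, via $A\Rightarrow C^k$ and $u'$, is compatible with pointwise multiplication $C^k\otimes C^{k-\beta}\Rightarrow C^{k-\beta}$. **Functions.** A $C^k$-function $f=(f_1,\dots,f_n):U\to\mathbb{R}^n$ is a $(B,k,\alpha,\beta)$-function in $\mathbb{X}$ if $\partial^\mu f_j\in B_{\alpha(i)}(U)\cap_{X(U)}C^{k-\beta(i)}(U)$ for all $j$, all $i\in\Lambda$ and all $|\mu|=i$. The set of these is $B_{\alpha,\beta}^k(U;\mathbb{X})$, and $B_{\alpha,\beta}^k(U,V;\mathbb{X})$ is the subset of those with $f(U)\subset V$. $C^k(U;V)$ is the set of $C^k$-maps $f:U\to\mathbb{R}^n$ with $f(U)\subset V$, $\operatorname{Diff}^k(U;V)$ the set of $C^k$-diffeomorphisms, and $\operatorname{Diff}_{\alpha,\beta}^k(U,V;\mathbb{X})=B_{\alpha,\beta}^k(U,V;\mathbb{X})\cap\operatorname{Diff}^k(U;V)$ the set of $(B,k,\alpha,\beta)$-diffeomorphisms.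 **Ordered.** Let $\Pi(i)$ be the set of partitions of $[i]=\{1,\dots,i\}$. An ordering function $\leq$ assigns to each $i\in\Lambda$ a total order $\leq_i$ on $\Pi(i)$ and, for each $\mu[i]\in\Pi(i)$, a total order on its set of blocks $\mu[i;r]$. For $\mu[i]$ with blocks $b_1<\dots<b_s$ put $\epsilon(\mu_\alpha[i])=\epsilon(\alpha(|b_s|),\epsilon(\alpha(|b_{s-1}|),\dots,\epsilon(\alpha(|b_2|),\alpha(|b_1|))\cdots))$ (equal to $\alpha(|b_1|)$ if $s=1$) and $\overline\epsilon_{\mu[i]}=\epsilon(\alpha(|\mu[i]|),\epsilon(\mu_\alpha[i]))$, where $|\mu[i]|$ is the number of blocks. If $\Pi(i)=\{P_1<_i\dots<_iP_N\}$, put $\alpha_\leq(i)=\delta(\overline\epsilon_{P_N},\delta(\overline\epsilon_{P_{N-1}},\dots,\delta(\overline\epsilon_{P_2},\overline\epsilon_{P_1})\cdots))$ and $\beta_\leq(i)=\max_{\mu[i]}\max_{\mu[i;r]}\{\beta(|\mu[i]|),\beta(|\mu[i;r]|)\}$. $B$ is ordered in $\mathbb{X}$ if for some ordering function there is an embedding of presheaves $B_{\alpha_\leq}\cap_XC^{k-\beta_\leq}\hookrightarrow B_\alpha\cap_XC^{k-\beta}$. **Absorption and retraction.** $B$ is fully left-absorbing (resp. fully right-absorbing) in $\mathbb{X}$ if for all open $U,V,W\subset\mathbb{R}^n$, $g\circ f$ is a $(B,k,\alpha,\beta)$-function in $\mathbb{X}$ from $U$ to $W$ whenever $f\in\operatorname{Diff}_{\alpha,\beta}^k(U,V;\mathbb{X})$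 and $g\in C^k(V;W)$ (resp. $f\in C^k(U;V)$ and $g\in\operatorname{Diff}_{\alpha,\beta}^k(V,W;\mathbb{X})$); fully absorbing means both. $B$ has retractible $(B,k,\alpha,\beta)$-diffeomorphisms in $\mathbb{X}$ if for all open $U,V$ there is a map $\overline r_{U,V}:\operatorname{Diff}^k(U;V)\to\operatorname{Diff}_{\alpha,\beta}^k(U,V;\mathbb{X})$ with $\overline r_{U,V}(f)=f$ for every $f\in\operatorname{Diff}_{\alpha,\beta}^k(U,V;\mathbb{X})$. A rule $\overline r$ choosing such $\overline r_{U,V}$ for all $U,V$ is a retraction presheaf. **Manifolds.** A $C^k$-manifold $(M,\mathcal{A})$ is a Hausdorff paracompact space $M$ with a maximal $C^k$-atlas $\mathcal{A}$ of charts $\varphi_i:U_i\to\mathbb{R}^n$; $\mathbf{Diff}^k$ is the category of these and $C^k$-maps. A $(B_{\alpha,\beta}^k,\mathbb{X})$-structure on it is a subatlas $\mathcal{B}\subset\mathcal{A}$ with $\varphi_j\circ\varphi_i^{-1}\in B_{\alpha,\beta}^k(\varphi_i(U_i\cap U_j);\mathbb{X})$ for all charts in $\mathcal{B}$. A $(B_{\alpha,\beta}^k,\mathbb{X})$-manifold is a $C^k$-manifold with such a structure. A morphism $(M,\mathcal{A},\mathcal{B})\to(M',\mathcal{A}',\mathcal{B}')$ is a $C^k$-map $f$ such that $\phi\circ f\circ\varphi^{-1}$ is a $(B,k,\alpha,\beta)$-function in $\mathbb{X}$ for all $\varphi\in\mathcal{B}$, $\phi\in\mathcal{B}'$. These form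 the category $\mathbf{Diff}_{\alpha,\beta}^{B,k}(\mathbb{X})$ under the hypotheses of the claim, and $F$ forgets $\mathcal{B}$. A functor is ambidextrous adjoint if it has a functor that is both left and right adjoint to it.
   Formalization: Positive dimension is asked only on nonempty open U (C^m(∅)=0); the pointwise sum is a map on direct sums, as it is not bilinear; nuclear is relaxed to a class of Fréchet spaces containing C^m(U), which is not nuclear for finite m; Fréchet spaces lie in one large set, enough up to isomorphism. *)

theory Defs
  imports "HOL-Analysis.Analysis" "HOL-Library.FuncSet" "HOL-Library.Disjoint_Sets"
    "HOL-Library.Extended_Nat"
begin

section \<open>Categories\<close>

record ('o, 'a) cat =
  Ob :: "'o set"
  Ar :: "'a set"
  cDom :: "'a \<Rightarrow> 'o"
  cCod :: "'a \<Rightarrow> 'o"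
  cId :: "'o \<Rightarrow> 'a"
  cComp :: "'a \<Rightarrow> 'a \<Rightarrow> 'a"  \<comment> \<open>\<open>cComp C g f\<close> is \<open>g \<circ> f\<close>\<close>

definition homs :: "('o, 'a) cat \<Rightarrow> 'o \<Rightarrow> 'o \<Rightarrow> 'a set" where
  "homs C x y = {f \<in> Ar C. cDom C f = x \<and> cCod C f = y}"

definition category :: "('o, 'a) cat \<Rightarrow> bool" where
  "category C \<longleftrightarrow>
     (\<forall>f\<in>Ar C. cDom C f \<in> Ob C \<and> cCod C f \<in> Ob C) \<and>
     (\<forall>x\<in>Ob C. cId C x \<in> homs C x x) \<and>
     (\<forall>x y z f g. f \<in> homs C x y \<longrightarrow> g \<in> homs C y z \<longrightarrow> cComp C g f \<in> homs C x z) \<and>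
     (\<forall>x y f. f \<in> homs C x y \<longrightarrow> cComp C f (cId C x) = f \<and> cComp C (cId C y) f = f) \<and>
     (\<forall>w x y z f g h. f \<in> homs C w x \<longrightarrow> g \<in> homs C x y \<longrightarrow> h \<in> homs C y z \<longrightarrow>
        cComp C h (cComp C g f) = cComp C (cComp C h g) f)"

definition monic :: "('o, 'a) cat \<Rightarrow> 'a \<Rightarrow> bool" where
  "monic C m \<longleftrightarrow> m \<in> Ar C \<and>
     (\<forall>x. \<forall>f\<in>homs C x (cDom C m). \<forall>g\<in>homs C x (cDom C m).
        cComp C m f = cComp C m g \<longrightarrow> f = g)"

definition iso_arrow :: "('o, 'a) cat \<Rightarrow> 'a \<Rightarrow> bool" where
  "iso_arrow C f \<longleftrightarrow> f \<in> Ar C \<and>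
     (\<exists>g\<in>homs C (cCod C f) (cDom C f).
        cComp C g f = cId C (cDom C f) \<and> cComp C f g = cId C (cCod C f))"

definition is_pullback :: "('o, 'a) cat \<Rightarrow> 'a \<Rightarrow> 'a \<Rightarrow> 'a \<Rightarrow> 'a \<Rightarrow> bool" where
  "is_pullback C f g p q \<longleftrightarrow>
     f \<in> Ar C \<and> g \<in> Ar C \<and> cCod C f = cCod C g \<and>
     p \<in> Ar C \<and> q \<in> Ar C \<and> cDom C p = cDom C q \<and> cCod C p = cDom C f \<and> cCod C q = cDom C g \<and>
     cComp C f p = cComp C g q \<and>
     (\<forall>x. \<forall>a\<in>homs C x (cDom C f). \<forall>b\<in>homs C x (cDom C g). cComp C f a = cComp C g b \<longrightarrow>
        (\<exists>!h. h \<in> homs C x (cDom C p) \<and> cComp C p h = a \<and> cComp C q h = b))"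

definition has_pullbacks :: "('o, 'a) cat \<Rightarrow> bool" where
  "has_pullbacks C \<longleftrightarrow>
     (\<forall>f\<in>Ar C. \<forall>g\<in>Ar C. cCod C f = cCod C g \<longrightarrow> (\<exists>p q. is_pullback C f g p q))"

record ('o, 'a, 'p, 'b) func =
  fo :: "'o \<Rightarrow> 'p"
  fa :: "'a \<Rightarrow> 'b"

definition is_functor :: "('o, 'a) cat \<Rightarrow> ('p, 'b) cat \<Rightarrow> ('o, 'a, 'p, 'b) func \<Rightarrow> bool" where
  "is_functor C D F \<longleftrightarrow> category C \<and> category D \<and>
     (\<forall>x\<in>Ob C. fo F x \<in> Ob D) \<and>
     (\<forall>x y f. f \<in> homs C x y \<longrightarrow> fa F f \<in> homs D (fo F x) (fo F y)) \<and>
     (\<forall>x\<in>Ob C. fa F (cId C x) = cId D (fo F x)) \<and>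
     (\<forall>x y z f g. f \<in> homs C x y \<longrightarrow> g \<in> homs C y z \<longrightarrow>
        fa F (cComp C g f) = cComp D (fa F g) (fa F f))"

definition is_embedding :: "('o, 'a) cat \<Rightarrow> ('p, 'b) cat \<Rightarrow> ('o, 'a, 'p, 'b) func \<Rightarrow> bool" where
  "is_embedding C D F \<longleftrightarrow> is_functor C D F \<and> inj_on (fo F) (Ob C) \<and>
     (\<forall>x y. inj_on (fa F) (homs C x y))"

definition func_id :: "('o, 'a, 'o, 'a) func" where
  "func_id = \<lparr>fo = (\<lambda>x. x), fa = (\<lambda>f. f)\<rparr>"

definition func_comp ::
  "('p, 'b, 'q, 'c) func \<Rightarrow> ('o, 'a, 'p, 'b) func \<Rightarrow> ('o, 'a, 'q, 'c) func" where
  "func_comp G F = \<lparr>fo = (\<lambda>x. fo G (fo F x)), fa = (\<lambda>f. fa G (fa F f))\<rparr>"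

definition nat_trans :: "('o, 'a) cat \<Rightarrow> ('p, 'b) cat \<Rightarrow> ('o, 'a, 'p, 'b) func \<Rightarrow>
    ('o, 'a, 'p, 'b) func \<Rightarrow> ('o \<Rightarrow> 'b) \<Rightarrow> bool" where
  "nat_trans C D F G t \<longleftrightarrow> is_functor C D F \<and> is_functor C D G \<and>
     (\<forall>x\<in>Ob C. t x \<in> homs D (fo F x) (fo G x)) \<and>
     (\<forall>x y f. f \<in> homs C x y \<longrightarrow> cComp D (fa G f) (t x) = cComp D (t y) (fa F f))"

definition nat_isomorphic :: "('o, 'a) cat \<Rightarrow> ('p, 'b) cat \<Rightarrow> ('o, 'a, 'p, 'b) func \<Rightarrow>
    ('o, 'a, 'p, 'b) func \<Rightarrow> bool" where
  "nat_isomorphic C D F G \<longleftrightarrow>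
     (\<exists>t. nat_trans C D F G t \<and> (\<forall>x\<in>Ob C. iso_arrow D (t x)))"

text \<open>\<open>adjunction C D L R\<close>: the functor \<open>L : C \<rightarrow> D\<close> is left adjoint to \<open>R : D \<rightarrow> C\<close>.\<close>

definition adjunction :: "('o, 'a) cat \<Rightarrow> ('p, 'b) cat \<Rightarrow> ('o, 'a, 'p, 'b) func \<Rightarrow>
    ('p, 'b, 'o, 'a) func \<Rightarrow> bool" where
  "adjunction C D L R \<longleftrightarrow> is_functor C D L \<and> is_functor D C R \<and>
     (\<exists>\<eta> \<epsilon>. nat_trans C C func_id (func_comp R L) \<eta> \<and>
            nat_trans D D (func_comp L R) func_id \<epsilon> \<and>
            (\<forall>x\<in>Ob C. cComp D (\<epsilon> (fo L x)) (fa L (\<eta> x)) = cId D (fo L x)) \<and>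
            (\<forall>y\<in>Ob D. cComp C (fa R (\<epsilon> y)) (\<eta> (fo R y)) = cId C (fo R y)))"

definition ambidextrous_adjoint :: "('p, 'b) cat \<Rightarrow> ('o, 'a) cat \<Rightarrow>
    ('p, 'b, 'o, 'a) func \<Rightarrow> bool" where
  "ambidextrous_adjoint D C F \<longleftrightarrow> (\<exists>G. adjunction C D G F \<and> adjunction D C F G)"


section \<open>Presheaves on Euclidean space\<close>

text \<open>Euclidean \<open>n\<close>-space is the space of sequences vanishing from index \<open>n\<close> on, so that
  coordinates are numbered from \<open>0\<close> and \<open>n = 0\<close> is allowed.\<close>

type_synonym pt = "nat \<Rightarrow> real"
type_synonym fn = "pt \<Rightarrow> real"

abbreviation Rn :: "nat \<Rightarrow> pt set" where
  "Rn n \<equiv> topspace (Euclidean_space n)"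

definition opens :: "nat \<Rightarrow> pt set set" where
  "opens n = {U. openin (Euclidean_space n) U}"

text \<open>\<open>pres P U V\<close> is the restriction morphism from \<open>U\<close> to a smaller open set \<open>V\<close>.\<close>

record ('o, 'a) psh =
  pob :: "pt set \<Rightarrow> 'o"
  pres :: "pt set \<Rightarrow> pt set \<Rightarrow> 'a"

definition is_psh :: "nat \<Rightarrow> ('o, 'a) cat \<Rightarrow> ('o, 'a) psh \<Rightarrow> bool" where
  "is_psh n C P \<longleftrightarrow> category C \<and>
     (\<forall>U\<in>opens n. pob P U \<in> Ob C \<and> pres P U U = cId C (pob P U)) \<and>
     (\<forall>U\<in>opens n. \<forall>V\<in>opens n. V \<subseteq> U \<longrightarrow> pres P U V \<in> homs C (pob P U) (pob P V)) \<and>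
     (\<forall>U\<in>opens n. \<forall>V\<in>opens n. \<forall>W\<in>opens n. W \<subseteq> V \<longrightarrow> V \<subseteq> U \<longrightarrow>
        pres P U W = cComp C (pres P V W) (pres P U V))"

definition psh_map :: "nat \<Rightarrow> ('o, 'a) cat \<Rightarrow> ('o, 'a) psh \<Rightarrow> ('o, 'a) psh \<Rightarrow>
    (pt set \<Rightarrow> 'a) \<Rightarrow> bool" where
  "psh_map n C P Q t \<longleftrightarrow> is_psh n C P \<and> is_psh n C Q \<and>
     (\<forall>U\<in>opens n. t U \<in> homs C (pob P U) (pob Q U)) \<and>
     (\<forall>U\<in>opens n. \<forall>V\<in>opens n. V \<subseteq> U \<longrightarrow>
        cComp C (pres Q U V) (t U) = cComp C (t V) (pres P U V))"

definition psh_monic :: "nat \<Rightarrow> ('o, 'a) cat \<Rightarrow> ('o, 'a) psh \<Rightarrow> ('o, 'a) psh \<Rightarrow>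
    (pt set \<Rightarrow> 'a) \<Rightarrow> bool" where
  "psh_monic n C P Q t \<longleftrightarrow> psh_map n C P Q t \<and> (\<forall>U\<in>opens n. monic C (t U))"

definition push :: "('o, 'a, 'p, 'b) func \<Rightarrow> ('o, 'a) psh \<Rightarrow> ('p, 'b) psh" where
  "push F P = \<lparr>pob = (\<lambda>U. fo F (pob P U)), pres = (\<lambda>U V. fa F (pres P U V))\<rparr>"


section \<open>Frechet spaces\<close>

record 'e vs =
  vcar :: "'e set"
  vzero :: 'e
  vadd :: "'e \<Rightarrow> 'e \<Rightarrow> 'e"
  vsmul :: "real \<Rightarrow> 'e \<Rightarrow> 'e"
  vtop :: "'e topology"

definition real_vs :: "('e, 'z) vs_scheme \<Rightarrow> bool" where
  "real_vs E \<longleftrightarrow>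
     vzero E \<in> vcar E \<and>
     (\<forall>x\<in>vcar E. \<forall>y\<in>vcar E. vadd E x y \<in> vcar E \<and> vadd E x y = vadd E y x) \<and>
     (\<forall>x\<in>vcar E. \<forall>y\<in>vcar E. \<forall>z\<in>vcar E. vadd E (vadd E x y) z = vadd E x (vadd E y z)) \<and>
     (\<forall>x\<in>vcar E. vadd E (vzero E) x = x \<and> (\<exists>y\<in>vcar E. vadd E x y = vzero E)) \<and>
     (\<forall>c. \<forall>x\<in>vcar E. vsmul E c x \<in> vcar E) \<and>
     (\<forall>c. \<forall>x\<in>vcar E. \<forall>y\<in>vcar E. vsmul E c (vadd E x y) = vadd E (vsmul E c x) (vsmul E c y)) \<and>
     (\<forall>c d. \<forall>x\<in>vcar E. vsmul E (c + d) x = vadd E (vsmul E c x) (vsmul E d x)) \<and>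
     (\<forall>c d. \<forall>x\<in>vcar E. vsmul E (c * d) x = vsmul E c (vsmul E d x)) \<and>
     (\<forall>x\<in>vcar E. vsmul E 1 x = x)"

definition vsub :: "('e, 'z) vs_scheme \<Rightarrow> 'e \<Rightarrow> 'e \<Rightarrow> 'e" where
  "vsub E x y = vadd E x (vsmul E (-1) y)"

primrec vsum :: "('e, 'z) vs_scheme \<Rightarrow> (nat \<Rightarrow> 'e) \<Rightarrow> nat \<Rightarrow> 'e" where
  "vsum E g 0 = vzero E"
| "vsum E g (Suc N) = vadd E (vsum E g N) (g N)"

definition seminorm :: "('e, 'z) vs_scheme \<Rightarrow> ('e \<Rightarrow> real) \<Rightarrow> bool" where
  "seminorm E p \<longleftrightarrow>
     (\<forall>x\<in>vcar E. \<forall>y\<in>vcar E. p (vadd E x y) \<le> p x + p y) \<and>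
     (\<forall>c. \<forall>x\<in>vcar E. p (vsmul E c x) = \<bar>c\<bar> * p x) \<and> (\<forall>x\<in>vcar E. 0 \<le> p x)"

text \<open>The topology defined by a family of seminorms; the vector space \<open>E\<close> enters only through its
  carrier and subtraction.\<close>

definition seminorm_open :: "('e, 'z) vs_scheme \<Rightarrow> ('e \<Rightarrow> real) set \<Rightarrow> 'e set \<Rightarrow> bool" where
  "seminorm_open E P O' \<longleftrightarrow> O' \<subseteq> vcar E \<and>
     (\<forall>x\<in>O'. \<exists>F e. finite F \<and> F \<subseteq> P \<and> 0 < e \<and>
        (\<forall>y\<in>vcar E. (\<forall>p\<in>F. p (vsub E y x) < e) \<longrightarrow> y \<in> O'))"

definition seminorm_topology :: "('e, 'z) vs_scheme \<Rightarrow> ('e \<Rightarrow> real) set \<Rightarrow> 'e topology" where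
  "seminorm_topology E P = topology (seminorm_open E P)"

lemma openin_seminorm_topology: "openin (seminorm_topology E P) = seminorm_open E P"
proof -
  have "seminorm_open E P (S \<inter> T)" if S: "seminorm_open E P S" and T: "seminorm_open E P T" for S T
    unfolding seminorm_open_def
  proof (intro conjI ballI)
    show "S \<inter> T \<subseteq> vcar E"
      using S by (auto simp: seminorm_open_def)
    fix x assume "x \<in> S \<inter> T"
    then obtain F e G d where
      "finite F" "F \<subseteq> P" "0 < e" "\<forall>y\<in>vcar E. (\<forall>p\<in>F. p (vsub E y x) < e) \<longrightarrow> y \<in> S"
      "finite G" "G \<subseteq> P" "0 < d" "\<forall>y\<in>vcar E. (\<forall>p\<in>G. p (vsub E y x) < d) \<longrightarrow> y \<in> T"
      using S T unfolding seminorm_open_def by (metis IntE)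
    then show "\<exists>F e. finite F \<and> F \<subseteq> P \<and> 0 < e \<and>
        (\<forall>y\<in>vcar E. (\<forall>p\<in>F. p (vsub E y x) < e) \<longrightarrow> y \<in> S \<inter> T)"
      by (intro exI[of _ "F \<union> G"] exI[of _ "min e d"]) auto
  qed
  moreover have "seminorm_open E P (\<Union>K)" if K: "\<forall>S\<in>K. seminorm_open E P S" for K
    unfolding seminorm_open_def
  proof (intro conjI ballI)
    show "\<Union>K \<subseteq> vcar E"
      using K by (auto simp: seminorm_open_def)
    fix x assume "x \<in> \<Union>K"
    then obtain S where S: "S \<in> K" "x \<in> S" by blast
    then obtain F e where "finite F" "F \<subseteq> P" "0 < e"
      "\<forall>y\<in>vcar E. (\<forall>p\<in>F. p (vsub E y x) < e) \<longrightarrow> y \<in> S"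
      using K unfolding seminorm_open_def by meson
    then show "\<exists>F e. finite F \<and> F \<subseteq> P \<and> 0 < e \<and>
        (\<forall>y\<in>vcar E. (\<forall>p\<in>F. p (vsub E y x) < e) \<longrightarrow> y \<in> \<Union>K)"
      using S(1) by (intro exI[of _ F] exI[of _ e]) blast
  qed
  ultimately show ?thesis
    unfolding seminorm_topology_def by (intro topology_inverse') (auto simp: istopology_def)
qed

definition frechet :: "'e vs \<Rightarrow> bool" where
  "frechet E \<longleftrightarrow> real_vs E \<and>
     (\<exists>p :: nat \<Rightarrow> 'e \<Rightarrow> real.
        (\<forall>m. seminorm E (p m)) \<and>
        vtop E = seminorm_topology E (range p) \<and>
        (\<forall>x\<in>vcar E. (\<forall>m. p m x = 0) \<longrightarrow> x = vzero E) \<and>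
        (\<forall>X. range X \<subseteq> vcar E \<longrightarrow>
           (\<forall>m e. 0 < e \<longrightarrow> (\<exists>N. \<forall>i\<ge>N. \<forall>j\<ge>N. p m (vsub E (X i) (X j)) < e)) \<longrightarrow>
           (\<exists>x\<in>vcar E. \<forall>m. (\<lambda>i. p m (vsub E (X i) x)) \<longlonglongrightarrow> 0)))"

definition cseminorm :: "'e vs \<Rightarrow> ('e \<Rightarrow> real) \<Rightarrow> bool" where
  "cseminorm E p \<longleftrightarrow> seminorm E p \<and> continuous_map (vtop E) euclideanreal p"

text \<open>For every continuous seminorm \<open>p\<close> there is a continuous seminorm \<open>q\<close> such that the canonical
  map of local Banach spaces \<open>E\<^sub>q \<rightarrow> E\<^sub>p\<close> is nuclear. The vectors \<open>y j\<close> of a nuclear representation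
  can be chosen in the image of \<open>E\<close>, which is dense in \<open>E\<^sub>p\<close>, so no completion is mentioned.\<close>

definition nuclear :: "'e vs \<Rightarrow> bool" where
  "nuclear E \<longleftrightarrow>
     (\<forall>p. cseminorm E p \<longrightarrow> (\<exists>q. cseminorm E q \<and>
        (\<exists>(c :: nat \<Rightarrow> real) (f :: nat \<Rightarrow> 'e \<Rightarrow> real) (y :: nat \<Rightarrow> 'e).
           summable (\<lambda>j. \<bar>c j\<bar>) \<and>
           (\<forall>j. (\<forall>u\<in>vcar E. \<forall>v\<in>vcar E. f j (vadd E u v) = f j u + f j v) \<and>
                (\<forall>r. \<forall>u\<in>vcar E. f j (vsmul E r u) = r * f j u) \<and>
                (\<forall>u\<in>vcar E. \<bar>f j u\<bar> \<le> q u)) \<and>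
           (\<forall>j. y j \<in> vcar E \<and> p (y j) \<le> 1) \<and>
           (\<forall>x\<in>vcar E. (\<lambda>N. p (vsub E x (vsum E (\<lambda>j. vsmul E (c j * f j x) (y j)) N)))
              \<longlonglongrightarrow> 0))))"

definition linear_vs :: "'e vs \<Rightarrow> 'f vs \<Rightarrow> ('e \<Rightarrow> 'f) \<Rightarrow> bool" where
  "linear_vs E F h \<longleftrightarrow> (\<forall>x\<in>vcar E. h x \<in> vcar F) \<and>
     (\<forall>x\<in>vcar E. \<forall>y\<in>vcar E. h (vadd E x y) = vadd F (h x) (h y)) \<and>
     (\<forall>c. \<forall>x\<in>vcar E. h (vsmul E c x) = vsmul F c (h x))"

definition clin :: "'e vs \<Rightarrow> 'f vs \<Rightarrow> ('e \<Rightarrow> 'f) \<Rightarrow> bool" where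
  "clin E F h \<longleftrightarrow> h \<in> extensional (vcar E) \<and> linear_vs E F h \<and>
     continuous_map (vtop E) (vtop F) h"

definition cbilin :: "'e vs \<Rightarrow> 'f vs \<Rightarrow> 'g vs \<Rightarrow> ('e \<Rightarrow> 'f \<Rightarrow> 'g) \<Rightarrow> bool" where
  "cbilin E F G b \<longleftrightarrow> (\<forall>x\<in>vcar E. linear_vs F G (b x)) \<and>
     (\<forall>y\<in>vcar F. linear_vs E G (\<lambda>x. b x y)) \<and>
     continuous_map (prod_topology (vtop E) (vtop F)) (vtop G) (\<lambda>(x, y). b x y)"

text \<open>All spaces are carried by subsets of the type \<open>fn\<close>. Its cardinality is at least that of
  every nuclear Frechet space, it contains the spaces of \<open>C\<^sup>k\<close>-functions literally, and
  completed projective tensor products and direct sums of spaces carried by it exist in it up to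
  isomorphism. A pairing assigns to two spaces a third one and a map of two arguments into it.\<close>

type_synonym pairing = "fn vs \<Rightarrow> fn vs \<Rightarrow> fn vs \<times> (fn \<Rightarrow> fn \<Rightarrow> fn)"

definition is_ptensor :: "fn vs \<Rightarrow> fn vs \<Rightarrow> fn vs \<Rightarrow> (fn \<Rightarrow> fn \<Rightarrow> fn) \<Rightarrow> bool" where
  "is_ptensor E F T t \<longleftrightarrow> frechet T \<and> cbilin E F T t \<and>
     (\<forall>(G :: fn vs) b. frechet G \<longrightarrow> cbilin E F G b \<longrightarrow>
        (\<exists>!h. clin T G h \<and> (\<forall>x\<in>vcar E. \<forall>y\<in>vcar F. h (t x y) = b x y)))"

definition ptensor :: pairing where
  "ptensor E F = (SOME (T, t). is_ptensor E F T t)"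

definition is_dsum :: "fn vs \<Rightarrow> fn vs \<Rightarrow> fn vs \<Rightarrow> (fn \<Rightarrow> fn \<Rightarrow> fn) \<Rightarrow> bool" where
  "is_dsum E F T t \<longleftrightarrow> frechet T \<and>
     bij_betw (\<lambda>(x, y). t x y) (vcar E \<times> vcar F) (vcar T) \<and>
     (\<forall>x\<in>vcar E. \<forall>x'\<in>vcar E. \<forall>y\<in>vcar F. \<forall>y'\<in>vcar F.
        t (vadd E x x') (vadd F y y') = vadd T (t x y) (t x' y')) \<and>
     (\<forall>c. \<forall>x\<in>vcar E. \<forall>y\<in>vcar F. t (vsmul E c x) (vsmul F c y) = vsmul T c (t x y)) \<and>
     homeomorphic_map (prod_topology (vtop E) (vtop F)) (vtop T) (\<lambda>(x, y). t x y)"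

definition dsum :: pairing where
  "dsum E F = (SOME (T, t). is_dsum E F T t)"

text \<open>The continuous linear map induced by a map \<open>b\<close> of two arguments (bilinear for
  \<open>ptensor\<close>, jointly linear for \<open>dsum\<close>).\<close>

definition lift :: "pairing \<Rightarrow> fn vs \<Rightarrow> fn vs \<Rightarrow> fn vs \<Rightarrow> (fn \<Rightarrow> fn \<Rightarrow> fn) \<Rightarrow> fn \<Rightarrow> fn" where
  "lift PR E F G b = (THE h. clin (fst (PR E F)) G h \<and>
     (\<forall>x\<in>vcar E. \<forall>y\<in>vcar F. h (snd (PR E F) x y) = b x y))"

definition pair_map :: "pairing \<Rightarrow> fn vs \<Rightarrow> fn vs \<Rightarrow> fn vs \<Rightarrow> fn vs \<Rightarrow>
    (fn \<Rightarrow> fn) \<Rightarrow> (fn \<Rightarrow> fn) \<Rightarrow> fn \<Rightarrow> fn" where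
  "pair_map PR E F E' F' f g =
     lift PR E F (fst (PR E' F')) (\<lambda>x y. snd (PR E' F') (f x) (g y))"


section \<open>Families of Frechet spaces\<close>

text \<open>Arrows \<open>(\<xi>, \<mu>)\<close> between families indexed by \<open>I\<close>: \<open>lidx\<close> is \<open>\<mu>\<close> and \<open>lmap\<close> is \<open>\<xi>\<close>.\<close>

record ('i, 'e) larr =
  ldom :: "'i \<Rightarrow> 'e vs"
  lcod :: "'i \<Rightarrow> 'e vs"
  lidx :: "'i \<Rightarrow> 'i"
  lmap :: "'i \<Rightarrow> 'e \<Rightarrow> 'e"

definition LSp :: "'e vs set \<Rightarrow> 'i set \<Rightarrow> ('i \<Rightarrow> 'e vs, ('i, 'e) larr) cat" where
  "LSp S I = \<lparr>
     Ob = I \<rightarrow>\<^sub>E S,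
     Ar = {a. ldom a \<in> I \<rightarrow>\<^sub>E S \<and> lcod a \<in> I \<rightarrow>\<^sub>E S \<and> lidx a \<in> I \<rightarrow>\<^sub>E I \<and>
              lmap a \<in> extensional I \<and>
              (\<forall>i\<in>I. clin (ldom a i) (lcod a (lidx a i)) (lmap a i))},
     cDom = ldom,
     cCod = lcod,
     cId = (\<lambda>E. \<lparr>ldom = E, lcod = E, lidx = (\<lambda>i\<in>I. i), lmap = (\<lambda>i\<in>I. \<lambda>x\<in>vcar (E i). x)\<rparr>),
     cComp = (\<lambda>b a. \<lparr>ldom = ldom a, lcod = lcod b, lidx = compose I (lidx b) (lidx a),
        lmap = (\<lambda>i\<in>I. compose (vcar (ldom a i)) (lmap b (lidx a i)) (lmap a i))\<rparr>)\<rparr>"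

type_synonym 'i lpsh = "('i \<Rightarrow> fn vs, ('i, fn) larr) psh"

definition over_id :: "'i set \<Rightarrow> ('i, 'e) larr \<Rightarrow> bool" where
  "over_id I a \<longleftrightarrow> lidx a = (\<lambda>i\<in>I. i)"

text \<open>In a presheaf of families the restriction morphisms do not move the index; only then
  reindexing and componentwise tensor products are again presheaves.\<close>

definition is_lpsh :: "nat \<Rightarrow> fn vs set \<Rightarrow> 'i set \<Rightarrow> 'i lpsh \<Rightarrow> bool" where
  "is_lpsh n S I P \<longleftrightarrow> is_psh n (LSp S I) P \<and>
     (\<forall>U\<in>opens n. \<forall>V\<in>opens n. V \<subseteq> U \<longrightarrow> over_id I (pres P U V))"

definition reindex :: "'j set \<Rightarrow> ('j \<Rightarrow> 'i) \<Rightarrow> 'i lpsh \<Rightarrow> 'j lpsh" where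
  "reindex J e P = \<lparr>
     pob = (\<lambda>U. \<lambda>j\<in>J. pob P U (e j)),
     pres = (\<lambda>U V. \<lparr>ldom = (\<lambda>j\<in>J. pob P U (e j)), lcod = (\<lambda>j\<in>J. pob P V (e j)),
        lidx = (\<lambda>j\<in>J. j), lmap = (\<lambda>j\<in>J. lmap (pres P U V) (e j))\<rparr>)\<rparr>"

text \<open>The family \<open>j \<mapsto> P(U)\<^bsub>a j\<^esub> \<odot> Q(U)\<^bsub>b j\<^esub>\<close> for the pairing \<open>\<odot>\<close> given by \<open>PR\<close>.\<close>

definition pair_psh :: "pairing \<Rightarrow> 'j set \<Rightarrow> 'i lpsh \<Rightarrow> ('j \<Rightarrow> 'i) \<Rightarrow> 'h lpsh \<Rightarrow> ('j \<Rightarrow> 'h) \<Rightarrow>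
    'j lpsh" where
  "pair_psh PR J P a Q b = \<lparr>
     pob = (\<lambda>U. \<lambda>j\<in>J. fst (PR (pob P U (a j)) (pob Q U (b j)))),
     pres = (\<lambda>U V. \<lparr>
        ldom = (\<lambda>j\<in>J. fst (PR (pob P U (a j)) (pob Q U (b j)))),
        lcod = (\<lambda>j\<in>J. fst (PR (pob P V (a j)) (pob Q V (b j)))),
        lidx = (\<lambda>j\<in>J. j),
        lmap = (\<lambda>j\<in>J. pair_map PR (pob P U (a j)) (pob Q U (b j)) (pob P V (a j)) (pob Q V (b j))
                 (lmap (pres P U V) (a j)) (lmap (pres Q U V) (b j)))\<rparr>)\<rparr>"


section \<open>Functions of class \<open>C\<^sup>k\<close>\<close>

definition pd1 :: "nat \<Rightarrow> fn \<Rightarrow> fn" where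
  "pd1 m f x = deriv (\<lambda>t. f (x(m := t))) (x m)"

primrec pdw :: "nat list \<Rightarrow> fn \<Rightarrow> fn" where
  "pdw [] f = f"
| "pdw (m # ms) f = pd1 m (pdw ms f)"

text \<open>All the successive partial derivatives making up \<open>pdw ms f\<close> exist on \<open>U\<close>.\<close>

primrec pdw_exists :: "pt set \<Rightarrow> nat list \<Rightarrow> fn \<Rightarrow> bool" where
  "pdw_exists U [] f = True"
| "pdw_exists U (m # ms) f = (pdw_exists U ms f \<and>
     (\<forall>x\<in>U. (\<lambda>t. pdw ms f (x(m := t))) field_differentiable (at (x m))))"

definition Ck_on :: "nat \<Rightarrow> enat \<Rightarrow> pt set \<Rightarrow> fn \<Rightarrow> bool" where
  "Ck_on n k U f \<longleftrightarrow> (\<forall>ms. set ms \<subseteq> {..<n} \<longrightarrow> enat (length ms) \<le> k \<longrightarrow>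
     pdw_exists U ms f \<and> continuous_on U (pdw ms f))"

definition multi_indices :: "nat \<Rightarrow> nat \<Rightarrow> (nat \<Rightarrow> nat) set" where
  "multi_indices n i = {\<mu>. (\<forall>j\<ge>n. \<mu> j = 0) \<and> (\<Sum>j<n. \<mu> j) = i}"

definition mi_word :: "nat \<Rightarrow> (nat \<Rightarrow> nat) \<Rightarrow> nat list" where
  "mi_word n \<mu> = concat (map (\<lambda>j. replicate (\<mu> j) j) [0..<n])"

definition mpd :: "nat \<Rightarrow> (nat \<Rightarrow> nat) \<Rightarrow> fn \<Rightarrow> fn" where
  "mpd n \<mu> f = pdw (mi_word n \<mu>) f"

definition mpd_exists :: "nat \<Rightarrow> pt set \<Rightarrow> (nat \<Rightarrow> nat) \<Rightarrow> fn \<Rightarrow> bool" where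
  "mpd_exists n U \<mu> f \<longleftrightarrow> pdw_exists U (mi_word n \<mu>) f"

text \<open>Functions on \<open>U\<close> are extensional, so that equality of elements is equality on \<open>U\<close>.\<close>

definition Ck_fun :: "nat \<Rightarrow> enat \<Rightarrow> pt set \<Rightarrow> fn set" where
  "Ck_fun n k U = {f \<in> extensional U. Ck_on n k U f}"

definition Ck_vs :: "nat \<Rightarrow> enat \<Rightarrow> pt set \<Rightarrow> fn vs" where
  "Ck_vs n k U = \<lparr>vcar = Ck_fun n k U, vzero = (\<lambda>x\<in>U. 0), vadd = (\<lambda>f g. \<lambda>x\<in>U. f x + g x),
     vsmul = (\<lambda>c f. \<lambda>x\<in>U. c * f x), vtop = undefined\<rparr>"

definition Ck_space :: "nat \<Rightarrow> enat \<Rightarrow> pt set \<Rightarrow> fn vs" where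
  "Ck_space n k U = (Ck_vs n k U)\<lparr>vtop := seminorm_topology (Ck_vs n k U)
     {\<lambda>f. SUP x\<in>K. \<bar>mpd n \<mu> f x\<bar> | K \<mu> i.
        compact K \<and> K \<noteq> {} \<and> K \<subseteq> U \<and> \<mu> \<in> multi_indices n i \<and> enat i \<le> k}\<rparr>"

text \<open>The presheaf \<open>U \<mapsto> (C\<^bsup>\<kappa> j\<^esup>(U))\<^bsub>j \<in> J\<^esub>\<close>.\<close>

definition Ck_psh :: "nat \<Rightarrow> 'j set \<Rightarrow> ('j \<Rightarrow> enat) \<Rightarrow> 'j lpsh" where
  "Ck_psh n J \<kappa> = \<lparr>
     pob = (\<lambda>U. \<lambda>j\<in>J. Ck_space n (\<kappa> j) U),
     pres = (\<lambda>U V. \<lparr>ldom = (\<lambda>j\<in>J. Ck_space n (\<kappa> j) U), lcod = (\<lambda>j\<in>J. Ck_space n (\<kappa> j) V),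
        lidx = (\<lambda>j\<in>J. j), lmap = (\<lambda>j\<in>J. \<lambda>f\<in>Ck_fun n (\<kappa> j) U. restrict f V)\<rparr>)\<rparr>"

text \<open>A class of Frechet spaces in which families are formed. It contains all nuclear Frechet
  spaces. For finite \<open>k\<close> the spaces \<open>C\<^sup>k(U)\<close> are Frechet but in general not nuclear, so that
  their membership is a separate requirement; for \<open>k = \<infinity>\<close> the class of all nuclear Frechet
  spaces qualifies.\<close>

definition space_class :: "nat \<Rightarrow> enat \<Rightarrow> nat set \<Rightarrow> (nat \<Rightarrow> nat) \<Rightarrow> fn vs set \<Rightarrow> bool" where
  "space_class n k \<Lambda> \<beta> S \<longleftrightarrow>
     (\<forall>E\<in>S. frechet E) \<and> (\<forall>E. frechet E \<and> nuclear E \<longrightarrow> E \<in> S) \<and>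
     (\<forall>U\<in>opens n. Ck_space n k U \<in> S \<and> (\<forall>i\<in>\<Lambda>. Ck_space n (k - enat (\<beta> i)) U \<in> S)) \<and>
     (\<forall>E\<in>S. \<forall>F\<in>S. fst (ptensor E F) \<in> S \<and> fst (dsum E F) \<in> S)"


section \<open>Distributive presheaves\<close>

definition mult_structure :: "pairing \<Rightarrow> nat set \<Rightarrow> (nat \<Rightarrow> fn vs) \<Rightarrow>
    (nat \<Rightarrow> nat \<Rightarrow> fn \<Rightarrow> fn) \<Rightarrow> (nat \<Rightarrow> nat \<Rightarrow> nat) \<Rightarrow> bool" where
  "mult_structure PR \<Lambda> E m e \<longleftrightarrow>
     (\<forall>i\<in>\<Lambda>. \<forall>j\<in>\<Lambda>. e i j \<in> \<Lambda> \<and> clin (fst (PR (E i) (E j))) (E (e i j)) (m i j))"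

definition app2 :: "pairing \<Rightarrow> (nat \<Rightarrow> fn vs) \<Rightarrow> (nat \<Rightarrow> nat \<Rightarrow> fn \<Rightarrow> fn) \<Rightarrow>
    nat \<Rightarrow> nat \<Rightarrow> fn \<Rightarrow> fn \<Rightarrow> fn" where
  "app2 PR E m i j x y = m i j (snd (PR (E i) (E j)) x y)"

definition distributive_space :: "pairing \<Rightarrow> nat set \<Rightarrow> (nat \<Rightarrow> fn vs) \<Rightarrow>
    (nat \<Rightarrow> nat \<Rightarrow> fn \<Rightarrow> fn) \<Rightarrow> (nat \<Rightarrow> nat \<Rightarrow> nat) \<Rightarrow>
    (nat \<Rightarrow> nat \<Rightarrow> fn \<Rightarrow> fn) \<Rightarrow> (nat \<Rightarrow> nat \<Rightarrow> nat) \<Rightarrow> bool" where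
  "distributive_space PR \<Lambda> E m \<epsilon> a \<delta> \<longleftrightarrow>
     mult_structure ptensor \<Lambda> E m \<epsilon> \<and> mult_structure PR \<Lambda> E a \<delta> \<and>
     (\<forall>i\<in>\<Lambda>. \<forall>j\<in>\<Lambda>. \<forall>l\<in>\<Lambda>.
        \<epsilon> i (\<delta> j l) = \<delta> (\<epsilon> i j) (\<epsilon> i l) \<and> \<epsilon> (\<delta> j l) i = \<delta> (\<epsilon> j i) (\<epsilon> l i) \<and>
        (\<forall>x\<in>vcar (E i). \<forall>y\<in>vcar (E j). \<forall>z\<in>vcar (E l).
           app2 ptensor E m i (\<delta> j l) x (app2 PR E a j l y z) =
             app2 PR E a (\<epsilon> i j) (\<epsilon> i l) (app2 ptensor E m i j x y) (app2 ptensor E m i l x z) \<and>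
           app2 ptensor E m (\<delta> j l) i (app2 PR E a j l y z) x =
             app2 PR E a (\<epsilon> j i) (\<epsilon> l i) (app2 ptensor E m j i y x) (app2 ptensor E m l i z x)))"

text \<open>The second structure \<open>+\<close> is given by continuous linear maps on \<open>E\<^sub>i \<otimes> E\<^sub>j\<close> or, so as to
  include actual additions (which are jointly linear and not bilinear), on \<open>E\<^sub>i \<oplus> E\<^sub>j\<close>; the field
  \<open>dpair\<close> records which. Morphisms over the identity of \<open>\<Lambda>\<close> can preserve the structures only if
  \<open>\<epsilon>\<close> and \<open>\<delta>\<close> are the same on all open sets.\<close>

record dpsh =
  base :: "nat lpsh"
  dpair :: pairing
  dmul :: "pt set \<Rightarrow> nat \<Rightarrow> nat \<Rightarrow> fn \<Rightarrow> fn"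
  deps :: "nat \<Rightarrow> nat \<Rightarrow> nat"
  dadd :: "pt set \<Rightarrow> nat \<Rightarrow> nat \<Rightarrow> fn \<Rightarrow> fn"
  ddel :: "nat \<Rightarrow> nat \<Rightarrow> nat"

definition is_dpsh :: "nat \<Rightarrow> fn vs set \<Rightarrow> nat set \<Rightarrow> dpsh \<Rightarrow> bool" where
  "is_dpsh n S \<Lambda> B \<longleftrightarrow> is_lpsh n S \<Lambda> (base B) \<and> dpair B \<in> {ptensor, dsum} \<and>
     (\<forall>U\<in>opens n.
        distributive_space (dpair B) \<Lambda> (pob (base B) U) (dmul B U) (deps B) (dadd B U) (ddel B)) \<and>
     (\<forall>U\<in>opens n. \<forall>V\<in>opens n. V \<subseteq> U \<longrightarrow>
        (\<forall>i\<in>\<Lambda>. \<forall>j\<in>\<Lambda>. \<forall>x\<in>vcar (pob (base B) U i). \<forall>y\<in>vcar (pob (base B) U j).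
           lmap (pres (base B) U V) (deps B i j) (app2 ptensor (pob (base B) U) (dmul B U) i j x y) =
             app2 ptensor (pob (base B) V) (dmul B V) i j
               (lmap (pres (base B) U V) i x) (lmap (pres (base B) U V) j y) \<and>
           lmap (pres (base B) U V) (ddel B i j) (app2 (dpair B) (pob (base B) U) (dadd B U) i j x y) =
             app2 (dpair B) (pob (base B) V) (dadd B V) i j
               (lmap (pres (base B) U V) i x) (lmap (pres (base B) U V) j y)))"

definition B_alpha :: "nat set \<Rightarrow> (nat \<Rightarrow> nat) \<Rightarrow> dpsh \<Rightarrow> nat lpsh" where
  "B_alpha \<Lambda> \<alpha> B = reindex \<Lambda> \<alpha> (base B)"

definition C_beta :: "nat \<Rightarrow> enat \<Rightarrow> nat set \<Rightarrow> (nat \<Rightarrow> nat) \<Rightarrow> nat lpsh" where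
  "C_beta n k \<Lambda> \<beta> = Ck_psh n \<Lambda> (\<lambda>i. k - enat (\<beta> i))"

text \<open>Sources and targets of the two families of operations, and the operations themselves as
  arrows of \<open>\<Lambda> \<times> \<Lambda>\<close>-indexed families.\<close>

definition B_source :: "pairing \<Rightarrow> nat set \<Rightarrow> (nat \<Rightarrow> nat) \<Rightarrow> dpsh \<Rightarrow> (nat \<times> nat) lpsh" where
  "B_source PR \<Lambda> \<alpha> B = pair_psh PR (\<Lambda> \<times> \<Lambda>) (B_alpha \<Lambda> \<alpha> B) fst (B_alpha \<Lambda> \<alpha> B) snd"

definition B_target :: "nat set \<Rightarrow> (nat \<Rightarrow> nat) \<Rightarrow> (nat \<Rightarrow> nat \<Rightarrow> nat) \<Rightarrow> dpsh \<Rightarrow>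
    (nat \<times> nat) lpsh" where
  "B_target \<Lambda> \<alpha> e B = reindex (\<Lambda> \<times> \<Lambda>) (\<lambda>(i, j). e (\<alpha> i) (\<alpha> j)) (base B)"

definition B_op :: "pairing \<Rightarrow> nat set \<Rightarrow> (nat \<Rightarrow> nat) \<Rightarrow> (nat \<Rightarrow> nat \<Rightarrow> nat) \<Rightarrow>
    (pt set \<Rightarrow> nat \<Rightarrow> nat \<Rightarrow> fn \<Rightarrow> fn) \<Rightarrow> dpsh \<Rightarrow> pt set \<Rightarrow> (nat \<times> nat, fn) larr" where
  "B_op PR \<Lambda> \<alpha> e m B U = \<lparr>
     ldom = pob (B_source PR \<Lambda> \<alpha> B) U, lcod = pob (B_target \<Lambda> \<alpha> e B) U,
     lidx = (\<lambda>ij\<in>\<Lambda> \<times> \<Lambda>. ij), lmap = (\<lambda>(i, j)\<in>\<Lambda> \<times> \<Lambda>. m U (\<alpha> i) (\<alpha> j))\<rparr>"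

definition C_source :: "pairing \<Rightarrow> nat \<Rightarrow> enat \<Rightarrow> nat set \<Rightarrow> (nat \<Rightarrow> nat) \<Rightarrow> (nat \<times> nat) lpsh" where
  "C_source PR n k \<Lambda> \<beta> = pair_psh PR (\<Lambda> \<times> \<Lambda>) (C_beta n k \<Lambda> \<beta>) fst (C_beta n k \<Lambda> \<beta>) snd"

definition C_target :: "nat \<Rightarrow> enat \<Rightarrow> nat set \<Rightarrow> (nat \<Rightarrow> nat) \<Rightarrow> (nat \<times> nat) lpsh" where
  "C_target n k \<Lambda> \<beta> = Ck_psh n (\<Lambda> \<times> \<Lambda>) (\<lambda>(i, j). k - enat (max (\<beta> i) (\<beta> j)))"

definition C_op :: "pairing \<Rightarrow> (real \<Rightarrow> real \<Rightarrow> real) \<Rightarrow> nat \<Rightarrow> enat \<Rightarrow> nat set \<Rightarrow> (nat \<Rightarrow> nat) \<Rightarrow>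
    pt set \<Rightarrow> (nat \<times> nat, fn) larr" where
  "C_op PR h n k \<Lambda> \<beta> U = \<lparr>
     ldom = pob (C_source PR n k \<Lambda> \<beta>) U, lcod = pob (C_target n k \<Lambda> \<beta>) U,
     lidx = (\<lambda>ij\<in>\<Lambda> \<times> \<Lambda>. ij),
     lmap = (\<lambda>(i, j)\<in>\<Lambda> \<times> \<Lambda>.
        lift PR (Ck_space n (k - enat (\<beta> i)) U) (Ck_space n (k - enat (\<beta> j)) U)
          (Ck_space n (k - enat (max (\<beta> i) (\<beta> j))) U) (\<lambda>f g. \<lambda>x\<in>U. h (f x) (g x)))\<rparr>"


section \<open>Intersection structures\<close>

record ('xo, 'xa) isp =
  xcat :: "('xo, 'xa) cat"
  gam :: "(nat \<Rightarrow> fn vs, (nat, fn) larr, 'xo, 'xa) func"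
  gamS :: "(nat \<times> nat \<Rightarrow> fn vs, (nat \<times> nat, fn) larr, 'xo, 'xa) func"
  X0 :: "('xo, 'xa) psh"
  Xm :: "('xo, 'xa) psh"
  Xa :: "('xo, 'xa) psh"
  iB :: "pt set \<Rightarrow> 'xa"
  iC :: "pt set \<Rightarrow> 'xa"
  jmB :: "pt set \<Rightarrow> 'xa"
  jmC :: "pt set \<Rightarrow> 'xa"
  jaB :: "pt set \<Rightarrow> 'xa"
  jaC :: "pt set \<Rightarrow> 'xa"

definition full_ambient :: "fn vs set \<Rightarrow> nat set \<Rightarrow> ('xo, 'xa) isp \<Rightarrow> bool" where
  "full_ambient S \<Lambda> \<X> \<longleftrightarrow> category (xcat \<X>) \<and> has_pullbacks (xcat \<X>) \<and>
     is_embedding (LSp S \<Lambda>) (xcat \<X>) (gam \<X>) \<and>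
     is_embedding (LSp S (\<Lambda> \<times> \<Lambda>)) (xcat \<X>) (gamS \<X>)"

definition full_isp :: "nat \<Rightarrow> enat \<Rightarrow> fn vs set \<Rightarrow> nat set \<Rightarrow> (nat \<Rightarrow> nat) \<Rightarrow> (nat \<Rightarrow> nat) \<Rightarrow> dpsh \<Rightarrow>
    ('xo, 'xa) isp \<Rightarrow> bool" where
  "full_isp n k S \<Lambda> \<alpha> \<beta> B \<X> \<longleftrightarrow> full_ambient S \<Lambda> \<X> \<and>
     psh_monic n (xcat \<X>) (push (gam \<X>) (B_alpha \<Lambda> \<alpha> B)) (X0 \<X>) (iB \<X>) \<and>
     psh_monic n (xcat \<X>) (push (gam \<X>) (C_beta n k \<Lambda> \<beta>)) (X0 \<X>) (iC \<X>) \<and>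
     psh_monic n (xcat \<X>) (push (gamS \<X>) (B_target \<Lambda> \<alpha> (deps B) B)) (Xm \<X>) (jmB \<X>) \<and>
     psh_monic n (xcat \<X>) (push (gamS \<X>) (C_target n k \<Lambda> \<beta>)) (Xm \<X>) (jmC \<X>) \<and>
     psh_monic n (xcat \<X>) (push (gamS \<X>) (B_target \<Lambda> \<alpha> (ddel B) B)) (Xa \<X>) (jaB \<X>) \<and>
     psh_monic n (xcat \<X>) (push (gamS \<X>) (C_target n k \<Lambda> \<beta>)) (Xa \<X>) (jaC \<X>)"

text \<open>\<open>D\<close> with \<open>u, u'\<close> represents the objectwise pullback of \<open>i : \<gamma> \<circ> P \<Rightarrow> X\<close> and
  \<open>i' : \<gamma> \<circ> Q \<Rightarrow> X\<close>. Component \<open>i\<close> of \<open>D\<close> is to lie over the components \<open>i\<close> of \<open>P\<close> and \<open>Q\<close>.\<close>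

definition is_intersection :: "nat \<Rightarrow> fn vs set \<Rightarrow> nat set \<Rightarrow> ('xo, 'xa) isp \<Rightarrow>
    nat lpsh \<Rightarrow> nat lpsh \<Rightarrow> (pt set \<Rightarrow> 'xa) \<Rightarrow> (pt set \<Rightarrow> 'xa) \<Rightarrow>
    nat lpsh \<Rightarrow> (pt set \<Rightarrow> (nat, fn) larr) \<Rightarrow> (pt set \<Rightarrow> (nat, fn) larr) \<Rightarrow> bool" where
  "is_intersection n S \<Lambda> \<X> P Q i i' D u u' \<longleftrightarrow> is_lpsh n S \<Lambda> D \<and>
     psh_map n (LSp S \<Lambda>) D P u \<and> psh_map n (LSp S \<Lambda>) D Q u' \<and>
     (\<forall>U\<in>opens n. over_id \<Lambda> (u U) \<and> over_id \<Lambda> (u' U) \<and>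
        is_pullback (xcat \<X>) (i U) (i' U) (fa (gam \<X>) (u U)) (fa (gam \<X>) (u' U)))"

text \<open>The objectwise pullback of \<open>s : P \<Rightarrow> Z\<close> and \<open>t : Q \<Rightarrow> Z\<close> is isomorphic to \<open>\<gamma>\<^sub>\<Sigma>\<close> of the
  presheaf \<open>(L\<^bsub>e (i, j)\<^esub>)\<close>.\<close>

definition sigma_represents :: "nat \<Rightarrow> fn vs set \<Rightarrow> nat set \<Rightarrow> ('xo, 'xa) isp \<Rightarrow>
    ('xo, 'xa) psh \<Rightarrow> ('xo, 'xa) psh \<Rightarrow> (pt set \<Rightarrow> 'xa) \<Rightarrow> (pt set \<Rightarrow> 'xa) \<Rightarrow>
    nat lpsh \<Rightarrow> (nat \<times> nat \<Rightarrow> nat) \<Rightarrow> bool" where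
  "sigma_represents n S \<Lambda> \<X> P Q s t L e \<longleftrightarrow> is_lpsh n S \<Lambda> L \<and> e \<in> \<Lambda> \<times> \<Lambda> \<rightarrow> \<Lambda> \<and>
     (\<exists>p q. psh_map n (xcat \<X>) (push (gamS \<X>) (reindex (\<Lambda> \<times> \<Lambda>) e L)) P p \<and>
            psh_map n (xcat \<X>) (push (gamS \<X>) (reindex (\<Lambda> \<times> \<Lambda>) e L)) Q q \<and>
            (\<forall>U\<in>opens n. is_pullback (xcat \<X>) (s U) (t U) (p U) (q U)))"

definition pb_mul_represents :: "nat \<Rightarrow> enat \<Rightarrow> fn vs set \<Rightarrow> nat set \<Rightarrow> (nat \<Rightarrow> nat) \<Rightarrow>
    (nat \<Rightarrow> nat) \<Rightarrow> dpsh \<Rightarrow> ('xo, 'xa) isp \<Rightarrow> nat lpsh \<Rightarrow> (nat \<times> nat \<Rightarrow> nat) \<Rightarrow> bool" where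
  "pb_mul_represents n k S \<Lambda> \<alpha> \<beta> B \<X> L e \<longleftrightarrow>
     sigma_represents n S \<Lambda> \<X>
       (push (gamS \<X>) (B_source ptensor \<Lambda> \<alpha> B)) (push (gamS \<X>) (C_source ptensor n k \<Lambda> \<beta>))
       (\<lambda>U. cComp (xcat \<X>) (jmB \<X> U) (fa (gamS \<X>) (B_op ptensor \<Lambda> \<alpha> (deps B) (dmul B) B U)))
       (\<lambda>U. cComp (xcat \<X>) (jmC \<X> U) (fa (gamS \<X>) (C_op ptensor (*) n k \<Lambda> \<beta> U))) L e"

definition pb_add_represents :: "nat \<Rightarrow> enat \<Rightarrow> fn vs set \<Rightarrow> nat set \<Rightarrow> (nat \<Rightarrow> nat) \<Rightarrow>
    (nat \<Rightarrow> nat) \<Rightarrow> dpsh \<Rightarrow> ('xo, 'xa) isp \<Rightarrow> nat lpsh \<Rightarrow> (nat \<times> nat \<Rightarrow> nat) \<Rightarrow> bool" where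
  "pb_add_represents n k S \<Lambda> \<alpha> \<beta> B \<X> L e \<longleftrightarrow>
     sigma_represents n S \<Lambda> \<X>
       (push (gamS \<X>) (B_source (dpair B) \<Lambda> \<alpha> B)) (push (gamS \<X>) (C_source dsum n k \<Lambda> \<beta>))
       (\<lambda>U. cComp (xcat \<X>) (jaB \<X> U) (fa (gamS \<X>) (B_op (dpair B) \<Lambda> \<alpha> (ddel B) (dadd B) B U)))
       (\<lambda>U. cComp (xcat \<X>) (jaC \<X> U) (fa (gamS \<X>) (C_op dsum (+) n k \<Lambda> \<beta> U))) L e"

definition proper_isp :: "nat \<Rightarrow> enat \<Rightarrow> fn vs set \<Rightarrow> nat set \<Rightarrow> (nat \<Rightarrow> nat) \<Rightarrow> (nat \<Rightarrow> nat) \<Rightarrow> dpsh \<Rightarrow>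
    ('xo, 'xa) isp \<Rightarrow> nat lpsh \<Rightarrow> (pt set \<Rightarrow> (nat, fn) larr) \<Rightarrow> (pt set \<Rightarrow> (nat, fn) larr) \<Rightarrow>
    bool" where
  "proper_isp n k S \<Lambda> \<alpha> \<beta> B \<X> D u u' \<longleftrightarrow>
     is_intersection n S \<Lambda> \<X> (B_alpha \<Lambda> \<alpha> B) (C_beta n k \<Lambda> \<beta>) (iB \<X>) (iC \<X>) D u u' \<and>
     (\<exists>L e. sigma_represents n S \<Lambda> \<X> (push (gamS \<X>) (B_target \<Lambda> \<alpha> (deps B) B))
        (push (gamS \<X>) (C_target n k \<Lambda> \<beta>)) (jmB \<X>) (jmC \<X>) L e) \<and>
     (\<exists>L e. sigma_represents n S \<Lambda> \<X> (push (gamS \<X>) (B_target \<Lambda> \<alpha> (ddel B) B))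
        (push (gamS \<X>) (C_target n k \<Lambda> \<beta>)) (jaB \<X>) (jaC \<X>) L e) \<and>
     (\<exists>L e. pb_mul_represents n k S \<Lambda> \<alpha> \<beta> B \<X> L e) \<and>
     (\<exists>L e. pb_add_represents n k S \<Lambda> \<alpha> \<beta> B \<X> L e)"


section \<open>\<open>C\<^bsub>n,\<beta>\<^esub>\<^bsup>k,\<alpha>\<^esup>\<close>-presheaves\<close>

text \<open>Positive real dimension of a family: some component is nonzero. The empty open set is left
  out because the function spaces on it vanish.\<close>

definition positive_dim :: "nat \<Rightarrow> 'i set \<Rightarrow> 'i lpsh \<Rightarrow> bool" where
  "positive_dim n I P \<longleftrightarrow>
     (\<forall>U\<in>opens n. U \<noteq> {} \<longrightarrow> (\<exists>i\<in>I. \<exists>x\<in>vcar (pob P U i). x \<noteq> vzero (pob P U i)))"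

definition C_presheaf :: "nat \<Rightarrow> enat \<Rightarrow> fn vs set \<Rightarrow> nat set \<Rightarrow> (nat \<Rightarrow> nat) \<Rightarrow> (nat \<Rightarrow> nat) \<Rightarrow> dpsh \<Rightarrow>
    ('xo, 'xa) isp \<Rightarrow> nat lpsh \<Rightarrow> (pt set \<Rightarrow> (nat, fn) larr) \<Rightarrow> bool" where
  "C_presheaf n k S \<Lambda> \<alpha> \<beta> B \<X> D u' \<longleftrightarrow>
     positive_dim n \<Lambda> D \<and>
     (\<exists>L e. pb_mul_represents n k S \<Lambda> \<alpha> \<beta> B \<X> L e \<and>
        positive_dim n (\<Lambda> \<times> \<Lambda>) (reindex (\<Lambda> \<times> \<Lambda>) e L)) \<and>
     (\<exists>L e. pb_add_represents n k S \<Lambda> \<alpha> \<beta> B \<X> L e \<and>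
        positive_dim n (\<Lambda> \<times> \<Lambda>) (reindex (\<Lambda> \<times> \<Lambda>) e L)) \<and>
     (\<exists>A a st. is_lpsh n S \<Lambda> A \<and>
        psh_monic n (LSp S \<Lambda>) A (Ck_psh n \<Lambda> (\<lambda>_. k)) a \<and>
        psh_map n (LSp S \<Lambda>) (pair_psh ptensor \<Lambda> A (\<lambda>i. i) D (\<lambda>i. i)) D st \<and>
        (\<forall>U\<in>opens n. over_id \<Lambda> (a U) \<and> over_id \<Lambda> (st U) \<and>
           (\<forall>i\<in>\<Lambda>. \<forall>x\<in>vcar (pob A U i). \<forall>y\<in>vcar (pob D U i).
              lmap (u' U) i (lmap (st U) i (snd (ptensor (pob A U i) (pob D U i)) x y)) =
                (\<lambda>p\<in>U. lmap (a U) i x p * lmap (u' U) i y p))))"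


section \<open>Functions and diffeomorphisms\<close>

definition CkM :: "nat \<Rightarrow> enat \<Rightarrow> pt set \<Rightarrow> (pt \<Rightarrow> pt) set" where
  "CkM n k U = {f \<in> extensional U. f ` U \<subseteq> Rn n \<and> (\<forall>j<n. Ck_on n k U (\<lambda>x. f x j))}"

definition Ck_maps :: "nat \<Rightarrow> enat \<Rightarrow> pt set \<Rightarrow> pt set \<Rightarrow> (pt \<Rightarrow> pt) set" where
  "Ck_maps n k U V = {f \<in> CkM n k U. f ` U \<subseteq> V}"

definition Ck_diffeos :: "nat \<Rightarrow> enat \<Rightarrow> pt set \<Rightarrow> pt set \<Rightarrow> (pt \<Rightarrow> pt) set" where
  "Ck_diffeos n k U V =
     {f \<in> Ck_maps n k U V. bij_betw f U V \<and> restrict (inv_into U f) V \<in> Ck_maps n k V U}"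

text \<open>The set of \<open>(B, k, \<alpha>, \<beta>)\<close>-functions on \<open>U\<close>, where \<open>D\<close> with \<open>u'\<close> is the intersection
  presheaf and \<open>D(U)\<^sub>i\<close> is regarded via \<open>u'\<close> as a space of functions on \<open>U\<close>.\<close>

definition B_fun :: "nat \<Rightarrow> enat \<Rightarrow> nat set \<Rightarrow> nat lpsh \<Rightarrow> (pt set \<Rightarrow> (nat, fn) larr) \<Rightarrow>
    pt set \<Rightarrow> (pt \<Rightarrow> pt) set" where
  "B_fun n k \<Lambda> D u' U = {f \<in> CkM n k U.
     \<forall>j<n. \<forall>i\<in>\<Lambda>. \<forall>\<mu>\<in>multi_indices n i. mpd_exists n U \<mu> (\<lambda>x. f x j) \<and>
       restrict (mpd n \<mu> (\<lambda>x. f x j)) U \<in> lmap (u' U) i ` vcar (pob D U i)}"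

text \<open>Below \<open>\<B>\<close> stands for the family \<open>U \<mapsto> B_fun n k \<Lambda> D u' U\<close>.\<close>

type_synonym fclass = "pt set \<Rightarrow> (pt \<Rightarrow> pt) set"

definition B_maps :: "fclass \<Rightarrow> pt set \<Rightarrow> pt set \<Rightarrow> (pt \<Rightarrow> pt) set" where
  "B_maps \<B> U V = {f \<in> \<B> U. f ` U \<subseteq> V}"

definition B_diffeos :: "nat \<Rightarrow> enat \<Rightarrow> fclass \<Rightarrow> pt set \<Rightarrow> pt set \<Rightarrow> (pt \<Rightarrow> pt) set" where
  "B_diffeos n k \<B> U V = B_maps \<B> U V \<inter> Ck_diffeos n k U V"

definition fully_left_absorbing :: "nat \<Rightarrow> enat \<Rightarrow> fclass \<Rightarrow> bool" where
  "fully_left_absorbing n k \<B> \<longleftrightarrow>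
     (\<forall>U\<in>opens n. \<forall>V\<in>opens n. \<forall>W\<in>opens n. \<forall>f\<in>B_diffeos n k \<B> U V. \<forall>g\<in>Ck_maps n k V W.
        compose U g f \<in> B_maps \<B> U W)"

definition fully_right_absorbing :: "nat \<Rightarrow> enat \<Rightarrow> fclass \<Rightarrow> bool" where
  "fully_right_absorbing n k \<B> \<longleftrightarrow>
     (\<forall>U\<in>opens n. \<forall>V\<in>opens n. \<forall>W\<in>opens n. \<forall>f\<in>Ck_maps n k U V. \<forall>g\<in>B_diffeos n k \<B> V W.
        compose U g f \<in> B_maps \<B> U W)"

definition fully_absorbing :: "nat \<Rightarrow> enat \<Rightarrow> fclass \<Rightarrow> bool" where
  "fully_absorbing n k \<B> \<longleftrightarrow> fully_left_absorbing n k \<B> \<and> fully_right_absorbing n k \<B>"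

type_synonym retraction = "pt set \<Rightarrow> pt set \<Rightarrow> (pt \<Rightarrow> pt) \<Rightarrow> pt \<Rightarrow> pt"

definition is_retraction :: "nat \<Rightarrow> enat \<Rightarrow> fclass \<Rightarrow> pt set \<Rightarrow> pt set \<Rightarrow>
    ((pt \<Rightarrow> pt) \<Rightarrow> pt \<Rightarrow> pt) \<Rightarrow> bool" where
  "is_retraction n k \<B> U V r \<longleftrightarrow> r \<in> Ck_diffeos n k U V \<rightarrow> B_diffeos n k \<B> U V \<and>
     (\<forall>f\<in>B_diffeos n k \<B> U V. r f = f)"

definition retractible_diffeos :: "nat \<Rightarrow> enat \<Rightarrow> fclass \<Rightarrow> bool" where
  "retractible_diffeos n k \<B> \<longleftrightarrow> (\<forall>U\<in>opens n. \<forall>V\<in>opens n. \<exists>r. is_retraction n k \<B> U V r)"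

definition retraction_presheaf :: "nat \<Rightarrow> enat \<Rightarrow> fclass \<Rightarrow> retraction \<Rightarrow> bool" where
  "retraction_presheaf n k \<B> r \<longleftrightarrow> (\<forall>U\<in>opens n. \<forall>V\<in>opens n. is_retraction n k \<B> U V (r U V))"


section \<open>Ordered presheaves\<close>

definition Parts :: "nat \<Rightarrow> nat set set set" where
  "Parts i = {P. partition_on {1..i} P}"

text \<open>The increasing enumeration of a finite set with respect to a total order.\<close>

definition enum_by :: "('a \<times> 'a) set \<Rightarrow> 'a set \<Rightarrow> 'a list" where
  "enum_by r A = (THE xs. set xs = A \<and> distinct xs \<and> sorted_wrt (\<lambda>x y. (x, y) \<in> r) xs)"

text \<open>\<open>nest f [a\<^sub>1, \<dots>, a\<^sub>s] = f a\<^sub>s (\<dots> (f a\<^sub>3 (f a\<^sub>2 a\<^sub>1)))\<close>\<close>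

definition nest :: "('a \<Rightarrow> 'a \<Rightarrow> 'a) \<Rightarrow> 'a list \<Rightarrow> 'a" where
  "nest f xs = fold f (tl xs) (hd xs)"

text \<open>An ordering function consists of a total order \<open>ro i\<close> on the partitions of \<open>{1..i}\<close> and total
  orders \<open>rb i P\<close> on the blocks of each partition \<open>P\<close>.\<close>

definition ordering_function :: "nat set \<Rightarrow> (nat \<Rightarrow> (nat set set \<times> nat set set) set) \<Rightarrow>
    (nat \<Rightarrow> nat set set \<Rightarrow> (nat set \<times> nat set) set) \<Rightarrow> bool" where
  "ordering_function \<Lambda> ro rb \<longleftrightarrow>
     (\<forall>i\<in>\<Lambda>. linear_order_on (Parts i) (ro i) \<and> (\<forall>P\<in>Parts i. linear_order_on P (rb i P)))"

text \<open>The only partition of \<open>[0]\<close> has no blocks; there the (empty) product over blocks is omitted.\<close>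

definition eps_part :: "(nat \<Rightarrow> nat) \<Rightarrow> (nat \<Rightarrow> nat \<Rightarrow> nat) \<Rightarrow> (nat set \<times> nat set) set \<Rightarrow>
    nat set set \<Rightarrow> nat" where
  "eps_part \<alpha> \<epsilon> r P =
     (if P = {} then \<alpha> 0
      else \<epsilon> (\<alpha> (card P)) (nest \<epsilon> (map (\<lambda>b. \<alpha> (card b)) (enum_by r P))))"

definition alpha_ord :: "(nat \<Rightarrow> nat) \<Rightarrow> (nat \<Rightarrow> nat \<Rightarrow> nat) \<Rightarrow> (nat \<Rightarrow> nat \<Rightarrow> nat) \<Rightarrow>
    (nat \<Rightarrow> (nat set set \<times> nat set set) set) \<Rightarrow>
    (nat \<Rightarrow> nat set set \<Rightarrow> (nat set \<times> nat set) set) \<Rightarrow> nat \<Rightarrow> nat" where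
  "alpha_ord \<alpha> \<epsilon> \<delta> ro rb i =
     nest \<delta> (map (\<lambda>P. eps_part \<alpha> \<epsilon> (rb i P) P) (enum_by (ro i) (Parts i)))"

definition beta_ord :: "(nat \<Rightarrow> nat) \<Rightarrow> nat \<Rightarrow> nat" where
  "beta_ord \<beta> i = Max ((\<lambda>P. Max (insert (\<beta> (card P)) ((\<lambda>b. \<beta> (card b)) ` P))) ` Parts i)"

text \<open>The numbers \<open>\<alpha> |b|\<close>, \<open>\<beta> |b|\<close> make sense only if the block sizes belong to \<open>\<Lambda>\<close>. The
  intersection of the reindexed presheaves is formed in the same presheaf \<open>X\<close>, which presupposes
  monic transformations \<open>i, i'\<close> into it.\<close>

definition ordered_in :: "nat \<Rightarrow> enat \<Rightarrow> fn vs set \<Rightarrow> nat set \<Rightarrow> (nat \<Rightarrow> nat) \<Rightarrow> (nat \<Rightarrow> nat) \<Rightarrow> dpsh \<Rightarrow>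
    ('xo, 'xa) isp \<Rightarrow> nat lpsh \<Rightarrow> bool" where
  "ordered_in n k S \<Lambda> \<alpha> \<beta> B \<X> D \<longleftrightarrow>
     (\<forall>i\<in>\<Lambda>. {1..i} \<subseteq> \<Lambda>) \<and>
     (\<exists>ro rb. ordering_function \<Lambda> ro rb \<and>
        (let Bo = B_alpha \<Lambda> (alpha_ord \<alpha> (deps B) (ddel B) ro rb) B;
             Co = C_beta n k \<Lambda> (beta_ord \<beta>)
         in \<exists>i i' D' v v' t.
              psh_monic n (xcat \<X>) (push (gam \<X>) Bo) (X0 \<X>) i \<and>
              psh_monic n (xcat \<X>) (push (gam \<X>) Co) (X0 \<X>) i' \<and>
              is_intersection n S \<Lambda> \<X> Bo Co i i' D' v v' \<and>
              psh_monic n (LSp S \<Lambda>) D' D t))"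


section \<open>Manifolds\<close>

type_synonym 'm chart = "'m set \<times> ('m \<Rightarrow> pt)"
type_synonym 'm mfd = "'m topology \<times> 'm chart set"
type_synonym 'm bmfd = "'m mfd \<times> 'm chart set"

definition paracompact_space :: "'m topology \<Rightarrow> bool" where
  "paracompact_space M \<longleftrightarrow>
     (\<forall>\<U>. (\<forall>U\<in>\<U>. openin M U) \<and> \<Union>\<U> = topspace M \<longrightarrow>
        (\<exists>\<V>. (\<forall>V\<in>\<V>. openin M V \<and> (\<exists>U\<in>\<U>. V \<subseteq> U)) \<and> \<Union>\<V> = topspace M \<and>
           (\<forall>x\<in>topspace M. \<exists>N. openin M N \<and> x \<in> N \<and> finite {V \<in> \<V>. V \<inter> N \<noteq> {}})))"

definition is_chart :: "nat \<Rightarrow> 'm topology \<Rightarrow> 'm chart \<Rightarrow> bool" where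
  "is_chart n M c \<longleftrightarrow> (case c of (U, \<phi>) \<Rightarrow> openin M U \<and> \<phi> \<in> extensional U \<and> \<phi> ` U \<in> opens n \<and>
     homeomorphic_map (subtopology M U) (subtopology (Euclidean_space n) (\<phi> ` U)) \<phi>)"

text \<open>\<open>\<psi> \<circ> f \<circ> \<phi>\<^sup>-\<^sup>1\<close> on its natural domain, for charts \<open>c = (U, \<phi>)\<close> and \<open>c' = (V, \<psi>)\<close>.\<close>

definition rep_dom :: "'m chart \<Rightarrow> ('m \<Rightarrow> 'm) \<Rightarrow> 'm chart \<Rightarrow> pt set" where
  "rep_dom c f c' = snd c ` {x \<in> fst c. f x \<in> fst c'}"

definition local_rep :: "'m chart \<Rightarrow> ('m \<Rightarrow> 'm) \<Rightarrow> 'm chart \<Rightarrow> pt \<Rightarrow> pt" where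
  "local_rep c f c' = (\<lambda>p\<in>rep_dom c f c'. snd c' (f (inv_into (fst c) (snd c) p)))"

abbreviation trans_dom :: "'m chart \<Rightarrow> 'm chart \<Rightarrow> pt set" where
  "trans_dom c c' \<equiv> rep_dom c (\<lambda>x. x) c'"

abbreviation transition :: "'m chart \<Rightarrow> 'm chart \<Rightarrow> pt \<Rightarrow> pt" where
  "transition c c' \<equiv> local_rep c (\<lambda>x. x) c'"

definition Ck_atlas :: "nat \<Rightarrow> enat \<Rightarrow> 'm topology \<Rightarrow> 'm chart set \<Rightarrow> bool" where
  "Ck_atlas n k M \<A> \<longleftrightarrow> (\<forall>c\<in>\<A>. is_chart n M c) \<and> \<Union>(fst ` \<A>) = topspace M \<and>
     (\<forall>c\<in>\<A>. \<forall>c'\<in>\<A>. transition c c' \<in> CkM n k (trans_dom c c'))"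

definition Ck_manifold :: "nat \<Rightarrow> enat \<Rightarrow> 'm mfd \<Rightarrow> bool" where
  "Ck_manifold n k X \<longleftrightarrow> (case X of (M, \<A>) \<Rightarrow>
     Hausdorff_space M \<and> paracompact_space M \<and> Ck_atlas n k M \<A> \<and>
     (\<forall>\<A>'. Ck_atlas n k M \<A>' \<longrightarrow> \<A> \<subseteq> \<A>' \<longrightarrow> \<A>' = \<A>))"

definition Ck_mfd_map :: "nat \<Rightarrow> enat \<Rightarrow> 'm mfd \<Rightarrow> 'm mfd \<Rightarrow> ('m \<Rightarrow> 'm) \<Rightarrow> bool" where
  "Ck_mfd_map n k X Y f \<longleftrightarrow> f \<in> extensional (topspace (fst X)) \<and>
     continuous_map (fst X) (fst Y) f \<and>
     (\<forall>c\<in>snd X. \<forall>c'\<in>snd Y. local_rep c f c' \<in> CkM n k (rep_dom c f c'))"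

definition Diff_cat :: "nat \<Rightarrow> enat \<Rightarrow> ('m mfd, 'm mfd \<times> 'm mfd \<times> ('m \<Rightarrow> 'm)) cat" where
  "Diff_cat n k = \<lparr>
     Ob = {X. Ck_manifold n k X},
     Ar = {(X, Y, f). Ck_manifold n k X \<and> Ck_manifold n k Y \<and> Ck_mfd_map n k X Y f},
     cDom = fst,
     cCod = (\<lambda>a. fst (snd a)),
     cId = (\<lambda>X. (X, X, \<lambda>x\<in>topspace (fst X). x)),
     cComp = (\<lambda>(Y, Z, g) (X, Y', f). (X, Z, compose (topspace (fst X)) g f))\<rparr>"

definition B_structure :: "fclass \<Rightarrow> 'm mfd \<Rightarrow> 'm chart set \<Rightarrow> bool" where
  "B_structure \<B> X \<S> \<longleftrightarrow> \<S> \<subseteq> snd X \<and> \<Union>(fst ` \<S>) = topspace (fst X) \<and>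
     (\<forall>c\<in>\<S>. \<forall>c'\<in>\<S>. transition c c' \<in> \<B> (trans_dom c c'))"

definition B_manifold :: "nat \<Rightarrow> enat \<Rightarrow> fclass \<Rightarrow> 'm bmfd \<Rightarrow> bool" where
  "B_manifold n k \<B> N \<longleftrightarrow> Ck_manifold n k (fst N) \<and> B_structure \<B> (fst N) (snd N)"

definition B_mfd_map :: "nat \<Rightarrow> enat \<Rightarrow> fclass \<Rightarrow> 'm bmfd \<Rightarrow> 'm bmfd \<Rightarrow> ('m \<Rightarrow> 'm) \<Rightarrow> bool" where
  "B_mfd_map n k \<B> N N' f \<longleftrightarrow> Ck_mfd_map n k (fst N) (fst N') f \<and>
     (\<forall>c\<in>snd N. \<forall>c'\<in>snd N'. local_rep c f c' \<in> \<B> (rep_dom c f c'))"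

definition BDiff_cat :: "nat \<Rightarrow> enat \<Rightarrow> fclass \<Rightarrow>
    ('m bmfd, 'm bmfd \<times> 'm bmfd \<times> ('m \<Rightarrow> 'm)) cat" where
  "BDiff_cat n k \<B> = \<lparr>
     Ob = {N. B_manifold n k \<B> N},
     Ar = {(N, N', f). B_manifold n k \<B> N \<and> B_manifold n k \<B> N' \<and> B_mfd_map n k \<B> N N' f},
     cDom = fst,
     cCod = (\<lambda>a. fst (snd a)),
     cId = (\<lambda>N. (N, N, \<lambda>x\<in>topspace (fst (fst N)). x)),
     cComp = (\<lambda>(Y, Z, g) (X, Y', f). (X, Z, compose (topspace (fst (fst X))) g f))\<rparr>"

definition forget :: "('m bmfd, 'm bmfd \<times> 'm bmfd \<times> ('m \<Rightarrow> 'm),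
    'm mfd, 'm mfd \<times> 'm mfd \<times> ('m \<Rightarrow> 'm)) func" where
  "forget = \<lparr>fo = fst, fa = (\<lambda>(N, N', f). (fst N, fst N', f))\<rparr>"

text \<open>The functor induced by a retraction presheaf \<open>r\<close>. On an overlap \<open>U \<inter> V\<close> of two charts
  \<open>(U, \<phi>)\<close>, \<open>(V, \<psi>)\<close> of the maximal atlas, the transition map \<open>\<psi> \<circ> \<phi>\<^sup>-\<^sup>1\<close> is replaced by its
  retraction, which gives the chart \<open>r (\<psi> \<circ> \<phi>\<^sup>-\<^sup>1) \<circ> \<phi>\<close> on \<open>U \<inter> V\<close>.\<close>

definition induced_chart :: "retraction \<Rightarrow> 'm chart \<Rightarrow> 'm chart \<Rightarrow> 'm chart" where
  "induced_chart r c c' = (fst c \<inter> fst c',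
     compose (fst c \<inter> fst c') (r (trans_dom c c') (trans_dom c' c) (transition c c')) (snd c))"

definition induced_structure :: "retraction \<Rightarrow> 'm mfd \<Rightarrow> 'm chart set" where
  "induced_structure r X = {induced_chart r c c' | c c'. c \<in> snd X \<and> c' \<in> snd X}"

definition induced_functor :: "retraction \<Rightarrow> ('m mfd, 'm mfd \<times> 'm mfd \<times> ('m \<Rightarrow> 'm),
    'm bmfd, 'm bmfd \<times> 'm bmfd \<times> ('m \<Rightarrow> 'm)) func" where
  "induced_functor r = \<lparr>fo = (\<lambda>X. (X, induced_structure r X)),
     fa = (\<lambda>(X, Y, f). ((X, induced_structure r X), (Y, induced_structure r Y), f))\<rparr>"

end

theory Submission
  imports Defs
begin

text \<open>
  Write \<open>\<B>(U)\<close> for the set of \<open>(B, k, \<alpha>, \<beta>)\<close>-functions on an open set \<open>U\<close>; it is contained in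
  the set of all maps of class \<open>C\<^sup>k\<close> on \<open>U\<close>. Retractibility together with absorption on one side
  turns this inclusion into an equality. Indeed, retracting the identity of \<open>U\<close> yields some
  \<open>(B, k, \<alpha>, \<beta>)\<close>-diffeomorphism \<open>h\<close> of \<open>U\<close>. If \<open>\<B>\<close> is left-absorbing, every \<open>C\<^sup>k\<close>-map \<open>g\<close> on
  \<open>U\<close> equals \<open>(g \<circ> h\<^sup>-\<^sup>1) \<circ> h\<close> and so belongs to \<open>\<B>(U)\<close> (\<open>left_absorbing_CkM\<close>); if \<open>\<B>\<close> is
  right-absorbing, one takes \<open>h\<close> on \<open>\<real>\<^sup>n\<close> and writes a \<open>C\<^sup>k\<close>-map \<open>f\<close> as \<open>h \<circ> (h\<^sup>-\<^sup>1 \<circ> f)\<close>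
  (\<open>right_absorbing_CkM\<close>).

  From this equality everything else follows formally. A retraction fixes every
  \<open>(B, k, \<alpha>, \<beta>)\<close>-diffeomorphism, hence every \<open>C\<^sup>k\<close>-diffeomorphism, and in particular all transition
  maps of a \<open>C\<^sup>k\<close>-atlas. The charts of the structure induced by a retraction presheaf on a manifold
  are therefore restrictions of charts of the maximal atlas to smaller open sets, and such
  restrictions belong to the maximal atlas (\<open>restrict_chart_in_atlas\<close>). So the induced structure is
  a \<open>\<B>\<close>-structure, and a map of manifolds is a morphism of \<open>\<B>\<close>-structures as soon as it is of class
  \<open>C\<^sup>k\<close>. The forgetful functor followed by the induced functor changes only the chosen subatlas, so
  the identity map of a manifold is an isomorphism between the new and the original structure; the
  opposite composite is the identity functor. Identity maps are therefore unit and counit of both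
  adjunctions (\<open>adjunction_object_functors\<close>), and they also compare the functors induced by two
  retraction presheaves.

  The analytic input is that \<open>C\<^sup>k\<close>-maps between open subsets of \<open>\<real>\<^sup>n\<close> are closed under composition
  (\<open>Ck_on_compose\<close>) and form a local class (\<open>CkM_locally\<close>). Since \<open>C\<^sup>k\<close> is defined here by
  iterated partial derivatives, composition requires the chain rule for functions with continuous
  partial derivatives (\<open>chain_rule_curve\<close>).
\<close>

section \<open>Open sets of Euclidean space\<close>

lemma opens_eq_openin_Rn: "opens n = {U. openin (top_of_set (Rn n)) U}"
  by (simp add: opens_def Euclidean_space_def euclidean_product_topology)

lemma Rn_in_opens: "Rn n \<in> opens n"
  by (simp add: opens_def)

lemma opens_subset_Rn: "U \<in> opens n \<Longrightarrow> U \<subseteq> Rn n"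
  by (simp add: opens_def openin_subset)

lemma Rn_coord: "x \<in> Rn n \<Longrightarrow> n \<le> i \<Longrightarrow> x i = 0"
  by (simp add: topspace_Euclidean_space)

text \<open>A neighbourhood in the product topology restricts only finitely many coordinates, and on
  \<open>\<real>\<^sup>n\<close> the coordinates from \<open>n\<close> on are constant. So boxes in the first \<open>n\<close> coordinates form a
  neighbourhood basis, which allows \<open>\<epsilon>\<close>-\<open>\<delta>\<close> arguments without a metric on sequences.\<close>

lemma opens_contains_box:
  assumes "U \<in> opens n" "x \<in> U"
  obtains d where "0 < d" "\<And>y. y \<in> Rn n \<Longrightarrow> (\<And>i. i < n \<Longrightarrow> \<bar>y i - x i\<bar> < d) \<Longrightarrow> y \<in> U"
proof -
  obtain T where T: "open T" "U = Rn n \<inter> T"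
    using assms(1) by (auto simp: opens_eq_openin_Rn openin_open)
  then have "openin (product_topology (\<lambda>i. euclidean) UNIV) T" "x \<in> T"
    using assms(2) by (auto simp: euclidean_product_topology)
  from product_topology_open_contains_basis[OF this]
  obtain X where X: "x \<in> (\<Pi>\<^sub>E i\<in>UNIV. X i)" "\<And>i. open (X i)" "(\<Pi>\<^sub>E i\<in>UNIV. X i) \<subseteq> T"
    by auto
  have "\<exists>e>0. \<forall>t. \<bar>t - x i\<bar> < e \<longrightarrow> t \<in> X i" for i
    using X(1) X(2)[of i] by (auto simp: open_dist dist_real_def PiE_iff)
  then obtain e where e: "\<And>i. 0 < e i" "\<And>i t. \<bar>t - x i\<bar> < e i \<Longrightarrow> t \<in> X i"
    by metis
  define d where "d = Min (insert 1 (e ` {..<n}))"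
  have d: "0 < d" "\<And>i. i < n \<Longrightarrow> d \<le> e i"
    unfolding d_def using e(1) by auto
  show thesis
  proof (rule that[OF d(1)])
    fix y assume y: "y \<in> Rn n" "\<And>i. i < n \<Longrightarrow> \<bar>y i - x i\<bar> < d"
    have "y i \<in> X i" for i
    proof (cases "i < n")
      case True
      then show ?thesis using y(2)[OF True] d(2)[OF True] by (intro e(2)) auto
    next
      case False
      moreover have "x \<in> Rn n" using assms opens_subset_Rn by blast
      ultimately have "y i = x i" using y(1) by (simp add: topspace_Euclidean_space)
      then show ?thesis using e by simp
    qed
    then show "y \<in> U" using X(3) T(2) y(1) by (auto simp: PiE_iff)
  qed
qed

lemma opens_vimage:
  fixes f :: fn
  assumes "U \<in> opens n" "continuous_on U f" "open T"
  shows "{x \<in> U. f x \<in> T} \<in> opens n"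
proof -
  have "openin (top_of_set U) (U \<inter> f -` T)"
    using assms(2,3) by (rule continuous_openin_preimage_gen)
  then have "openin (top_of_set (Rn n)) (U \<inter> f -` T)"
    using assms(1) openin_trans unfolding opens_eq_openin_Rn by blast
  moreover have "U \<inter> f -` T = {x \<in> U. f x \<in> T}" by auto
  ultimately show ?thesis by (simp add: opens_eq_openin_Rn)
qed

text \<open>Partial derivatives look at a function along coordinate lines; near the base point such a
  line stays in the open set.\<close>

lemma eventually_fun_upd_in_opens:
  assumes "U \<in> opens n" "x \<in> U" "m < n"
  shows "\<forall>\<^sub>F t in nhds (x m). x(m := t) \<in> U"
proof -
  obtain d where d: "0 < d" "\<And>y. y \<in> Rn n \<Longrightarrow> (\<And>i. i < n \<Longrightarrow> \<bar>y i - x i\<bar> < d) \<Longrightarrow> y \<in> U"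
    using opens_contains_box[OF assms(1,2)] by metis
  have "x \<in> Rn n" using assms opens_subset_Rn by blast
  then have "x(m := t) \<in> U" if "dist t (x m) < d" for t
    using that assms(3) d(1) by (intro d(2)) (auto simp: topspace_Euclidean_space dist_real_def)
  then show ?thesis using d(1) unfolding eventually_nhds_metric by blast
qed

section \<open>The chain rule in coordinates\<close>

definition partially_differentiable :: "nat \<Rightarrow> pt set \<Rightarrow> fn \<Rightarrow> bool" where
  "partially_differentiable n U f \<longleftrightarrow>
     (\<forall>m<n. \<forall>x\<in>U. (\<lambda>t. f (x(m := t))) field_differentiable at (x m))"

lemma has_partial_derivative:
  assumes "partially_differentiable n U f" "m < n" "x \<in> U"
  shows "((\<lambda>t. f (x(m := t))) has_field_derivative pd1 m f x) (at (x m))"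
  using assms by (simp add: partially_differentiable_def pd1_def DERIV_deriv_iff_field_differentiable)

lemma pd1_eqI:
  "((\<lambda>t. f (x(m := t))) has_field_derivative d) (at (x m)) \<Longrightarrow> pd1 m f x = d"
  by (simp add: pd1_def DERIV_imp_deriv)

text \<open>Continuous partial derivatives give a total derivative: passing from \<open>a\<close> to \<open>z\<close> one coordinate
  at a time, each step changes \<open>f\<close> by almost its partial derivative at \<open>a\<close>, by the mean value
  inequality along a coordinate line.\<close>

lemma total_differential:
  assumes V: "V \<in> opens n" "a \<in> V" and f: "partially_differentiable n V f"
    and c: "\<And>m. m < n \<Longrightarrow> continuous_on V (pd1 m f)" and e: "0 < e"
  obtains d where "0 < d"
    "\<And>z. z \<in> Rn n \<Longrightarrow> (\<And>i. i < n \<Longrightarrow> \<bar>z i - a i\<bar> < d) \<Longrightarrow>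
       \<bar>f z - f a - (\<Sum>m<n. pd1 m f a * (z m - a m))\<bar> \<le> e * (\<Sum>m<n. \<bar>z m - a m\<bar>)"
proof -
  define W where "W m = {x \<in> V. pd1 m f x \<in> ball (pd1 m f a) e}" for m
  have "\<exists>d>0. \<forall>y\<in>Rn n. (\<forall>i<n. \<bar>y i - a i\<bar> < d) \<longrightarrow> y \<in> W m" if "m < n" for m
  proof -
    have "W m \<in> opens n" "a \<in> W m"
      unfolding W_def using V e opens_vimage[OF V(1) c[OF that] open_ball] by auto
    from opens_contains_box[OF this] show ?thesis by metis
  qed
  then obtain d0 where d0: "\<And>m. m < n \<Longrightarrow> 0 < d0 m"
    "\<And>m y. m < n \<Longrightarrow> y \<in> Rn n \<Longrightarrow> \<forall>i<n. \<bar>y i - a i\<bar> < d0 m \<Longrightarrow> y \<in> W m"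
    by metis
  define d where "d = Min (insert 1 (d0 ` {..<n}))"
  have d: "0 < d" "\<And>m. m < n \<Longrightarrow> d \<le> d0 m" unfolding d_def using d0(1) by auto
  have a: "a \<in> Rn n" using V opens_subset_Rn by blast
  show thesis
  proof (rule that[OF d(1)])
    fix z assume z: "z \<in> Rn n" "\<And>i. i < n \<Longrightarrow> \<bar>z i - a i\<bar> < d"
    \<comment> \<open>the vertices of a polygonal path from \<open>a\<close> to \<open>z\<close> along the coordinate directions\<close>
    define w where "w m = (\<lambda>i. if i < m then z i else a i)" for m :: nat
    have step: "\<bar>f (w (Suc m)) - f (w m) - pd1 m f a * (z m - a m)\<bar> \<le> e * \<bar>z m - a m\<bar>"
      if m: "m < n" for m
    proof -
      \<comment> \<open>subtracting the linear part makes the derivative smaller than \<open>e\<close>\<close>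
      define g where "g t = f ((w m)(m := t)) - pd1 m f a * t" for t
      have seg: "(w m)(m := t) \<in> W m" if "t \<in> ball (a m) d" for t
      proof (rule d0(2)[OF m])
        show "(w m)(m := t) \<in> Rn n"
          using z(1) a m by (auto simp: w_def topspace_Euclidean_space)
        show "\<forall>i<n. \<bar>((w m)(m := t)) i - a i\<bar> < d0 m"
        proof (intro allI impI)
          fix i assume "i < n"
          have "\<bar>((w m)(m := t)) i - a i\<bar> < d"
            using that z(2)[OF \<open>i < n\<close>] d(1) by (auto simp: w_def dist_real_def)
          with d(2)[OF m] show "\<bar>((w m)(m := t)) i - a i\<bar> < d0 m" by simp
        qed
      qed
      have der: "(g has_field_derivative pd1 m f ((w m)(m := t)) - pd1 m f a) (at t within ball (a m) d)"
        if "t \<in> ball (a m) d" for t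
      proof -
        have "(w m)(m := t) \<in> V" using seg[OF that] by (simp add: W_def)
        from has_partial_derivative[OF f m this]
        have "((\<lambda>t. f ((w m)(m := t))) has_field_derivative pd1 m f ((w m)(m := t))) (at t)"
          by simp
        from DERIV_diff[OF this DERIV_cmult_Id] show ?thesis
          unfolding g_def by (rule has_field_derivative_at_within)
      qed
      have "norm (g (z m) - g (a m)) \<le> e * norm (z m - a m)"
      proof (rule field_differentiable_bound[OF convex_ball der])
        fix t assume "t \<in> ball (a m) d"
        from seg[OF this] show "norm (pd1 m f ((w m)(m := t)) - pd1 m f a) \<le> e"
          by (simp add: W_def dist_real_def abs_minus_commute)
      next
        show "z m \<in> ball (a m) d" "a m \<in> ball (a m) d"
          using z(2)[OF m] d(1) by (simp_all add: dist_real_def abs_minus_commute)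
      qed
      moreover have "(w m)(m := z m) = w (Suc m)"
        by (rule ext) (simp add: w_def)
      moreover have "(w m)(m := a m) = w m"
        by (rule ext) (simp add: w_def)
      ultimately show ?thesis by (simp add: g_def algebra_simps)
    qed
    have "\<bar>f (w m) - f a - (\<Sum>j<m. pd1 j f a * (z j - a j))\<bar> \<le> e * (\<Sum>j<m. \<bar>z j - a j\<bar>)" if "m \<le> n" for m
      using that
    proof (induction m)
      case 0
      then show ?case by (simp add: w_def)
    next
      case (Suc m)
      from Suc.IH Suc.prems step[of m] show ?case by (simp add: algebra_simps)
    qed
    moreover have "w n = z" using z(1) a by (auto simp: w_def fun_eq_iff topspace_Euclidean_space)
    ultimately show "\<bar>f z - f a - (\<Sum>m<n. pd1 m f a * (z m - a m))\<bar> \<le> e * (\<Sum>m<n. \<bar>z m - a m\<bar>)"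
      by auto
  qed
qed

text \<open>The chain rule for \<open>f \<circ> y\<close>. The remainder \<open>R\<close> of the linear approximation of \<open>f\<close> is small
  compared to the increment of \<open>y\<close>, which is itself at most proportional to the increment of the
  parameter. Taking for \<open>y\<close> a map of several variables along a coordinate line gives the partial
  derivatives of a composite.\<close>

lemma chain_rule_curve:
  fixes y :: "real \<Rightarrow> pt"
  assumes V: "V \<in> opens n" and f: "partially_differentiable n V f"
    and c: "\<And>m. m < n \<Longrightarrow> continuous_on V (pd1 m f)"
    and y: "y s \<in> V" "\<forall>\<^sub>F t in nhds s. y t \<in> V"
    and y': "\<And>m. m < n \<Longrightarrow> ((\<lambda>t. y t m) has_field_derivative y' m) (at s)"
  shows "((\<lambda>t. f (y t)) has_field_derivative (\<Sum>m<n. pd1 m f (y s) * y' m)) (at s)"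
proof -
  define R where "R t = f (y t) - f (y s) - (\<Sum>m<n. pd1 m f (y s) * (y t m - y s m))" for t
  define q where "q t = (\<Sum>m<n. \<bar>(y t m - y s m) / (t - s)\<bar>)" for t
  \<comment> \<open>a bound for the difference quotients of the coordinates of \<open>y\<close> near \<open>s\<close>\<close>
  define Q where "Q = (\<Sum>m<n. \<bar>y' m\<bar>) + 1"
  have Q: "0 < Q" unfolding Q_def by (simp add: sum_nonneg add_nonneg_pos)
  have "(q \<longlongrightarrow> (\<Sum>m<n. \<bar>y' m\<bar>)) (at s)"
    unfolding q_def using y' by (intro tendsto_sum tendsto_rabs) (simp add: has_field_derivative_iff)
  then have q: "\<forall>\<^sub>F t in at s. q t < Q"
    by (rule order_tendstoD) (simp add: Q_def)
  have "((\<lambda>t. R t / (t - s)) \<longlongrightarrow> 0) (at s)"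
  proof (rule tendstoI)
    fix e :: real assume "0 < e"
    then have "0 < e / Q" using Q by simp
    then obtain d where d: "0 < d"
      "\<And>z. z \<in> Rn n \<Longrightarrow> (\<And>i. i < n \<Longrightarrow> \<bar>z i - y s i\<bar> < d) \<Longrightarrow>
       \<bar>f z - f (y s) - (\<Sum>m<n. pd1 m f (y s) * (z m - y s m))\<bar> \<le> e / Q * (\<Sum>m<n. \<bar>z m - y s m\<bar>)"
      using total_differential[OF V y(1) f c] by blast
    have "\<forall>\<^sub>F t in at s. \<forall>i\<in>{..<n}. \<bar>y t i - y s i\<bar> < d"
    proof (rule eventually_ball_finite)
      show "\<forall>i\<in>{..<n}. \<forall>\<^sub>F t in at s. \<bar>y t i - y s i\<bar> < d"
      proof
        fix i assume "i \<in> {..<n}"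
        then have "isCont (\<lambda>t. y t i) s" using y' DERIV_isCont by blast
        then have "\<forall>\<^sub>F t in at s. dist (y t i) (y s i) < d"
          using d(1) by (simp add: isCont_def tendsto_iff)
        then show "\<forall>\<^sub>F t in at s. \<bar>y t i - y s i\<bar> < d" by (simp add: dist_real_def)
      qed
    qed simp
    moreover have "\<forall>\<^sub>F t in at s. y t \<in> V" using y(2) by (rule eventually_at_filter[THEN iffD2, OF eventually_mono]) simp
    moreover have "\<forall>\<^sub>F t in at s. t \<noteq> s" by (simp add: eventually_at_filter)
    ultimately show "\<forall>\<^sub>F t in at s. dist (R t / (t - s)) 0 < e"
      using q
    proof eventually_elim
      case (elim t)
      have "y t \<in> Rn n" using elim(2) V opens_subset_Rn by blast
      then have "\<bar>R t\<bar> \<le> e / Q * (\<Sum>m<n. \<bar>y t m - y s m\<bar>)"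
        unfolding R_def using elim(1) by (intro d(2)) auto
      then have "\<bar>R t\<bar> / \<bar>t - s\<bar> \<le> e / Q * (\<Sum>m<n. \<bar>y t m - y s m\<bar>) / \<bar>t - s\<bar>"
        by (rule divide_right_mono) simp
      also have "\<dots> = e / Q * q t"
        unfolding q_def abs_divide sum_divide_distrib[symmetric] by simp
      also have "\<dots> < e / Q * Q" using elim(4) \<open>0 < e\<close> Q by (intro mult_strict_left_mono) auto
      finally show ?case using Q by (simp add: abs_divide)
    qed
  qed
  moreover have "R s = 0" by (simp add: R_def)
  ultimately have "(R has_field_derivative 0) (at s)"
    by (simp add: has_field_derivative_iff)
  then have "((\<lambda>t. R t + f (y s) + (\<Sum>m<n. pd1 m f (y s) * (y t m - y s m))) has_field_derivative
      0 + 0 + (\<Sum>m<n. pd1 m f (y s) * y' m)) (at s)"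
    using y' by (intro DERIV_add DERIV_sum) (auto intro!: derivative_eq_intros)
  moreover have "(\<lambda>t. R t + f (y s) + (\<Sum>m<n. pd1 m f (y s) * (y t m - y s m))) = (\<lambda>t. f (y t))"
    by (simp add: R_def fun_eq_iff)
  ultimately show ?thesis by simp
qed

section \<open>The calculus of functions of class \<open>C\<^sup>k\<close>\<close>

text \<open>Only finite orders of differentiability matter, so that proofs can use induction on the order
  even for \<open>k = \<infinity>\<close>.\<close>

lemma Ck_onI_finite:
  assumes "\<And>j. enat j \<le> k \<Longrightarrow> Ck_on n (enat j) U f"
  shows "Ck_on n k U f"
  unfolding Ck_on_def
proof (intro allI impI)
  fix ms assume "set ms \<subseteq> {..<n}" "enat (length ms) \<le> k"
  with assms[of "length ms"] show "pdw_exists U ms f \<and> continuous_on U (pdw ms f)"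
    by (auto simp: Ck_on_def)
qed

lemma Ck_on_mono: "Ck_on n k U f \<Longrightarrow> j \<le> k \<Longrightarrow> Ck_on n j U f"
  by (auto simp: Ck_on_def)

lemma Ck_on_imp_continuous_on: "Ck_on n k U f \<Longrightarrow> continuous_on U f"
  unfolding Ck_on_def by (auto dest: spec[of _ "[]"] simp: zero_enat_def[symmetric])

lemma pdw_append: "pdw (ms @ [m]) f = pdw ms (pd1 m f)"
  by (induction ms) auto

lemma pdw_exists_append:
  "pdw_exists U (ms @ [m]) f \<longleftrightarrow>
     (\<forall>x\<in>U. (\<lambda>t. f (x(m := t))) field_differentiable at (x m)) \<and> pdw_exists U ms (pd1 m f)"
  by (induction ms) (simp_all only: append_Nil append_Cons pdw.simps pdw_exists.simps pdw_append simp_thms conj_assoc)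

text \<open>In \<open>pdw\<close> the last letter of a word is the derivative taken first. Splitting it off gives the
  recursive characterisation of \<open>C\<^sup>k\<close> on which all inductions below rest.\<close>

lemma Ck_on_Suc:
  "Ck_on n (enat (Suc k)) U f \<longleftrightarrow>
     continuous_on U f \<and> partially_differentiable n U f \<and> (\<forall>m<n. Ck_on n (enat k) U (pd1 m f))"
proof (intro iffI conjI allI impI)
  assume f: "Ck_on n (enat (Suc k)) U f"
  show "continuous_on U f" using f by (rule Ck_on_imp_continuous_on)
  show "partially_differentiable n U f"
    unfolding partially_differentiable_def
  proof (intro allI impI)
    fix m assume "m < n"
    with f have "pdw_exists U [m] f"
      unfolding Ck_on_def by (auto dest: spec[of _ "[m]"])
    then show "\<forall>x\<in>U. (\<lambda>t. f (x(m := t))) field_differentiable at (x m)" by simp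
  qed
  fix m assume m: "m < n"
  show "Ck_on n (enat k) U (pd1 m f)"
    unfolding Ck_on_def
  proof (intro allI impI)
    fix ms assume "set ms \<subseteq> {..<n}" "enat (length ms) \<le> enat k"
    with m have "set (ms @ [m]) \<subseteq> {..<n}" "enat (length (ms @ [m])) \<le> enat (Suc k)" by auto
    with f show "pdw_exists U ms (pd1 m f) \<and> continuous_on U (pdw ms (pd1 m f))"
      unfolding Ck_on_def by (metis pdw_append pdw_exists_append)
  qed
next
  assume f: "continuous_on U f \<and> partially_differentiable n U f \<and> (\<forall>m<n. Ck_on n (enat k) U (pd1 m f))"
  show "Ck_on n (enat (Suc k)) U f"
    unfolding Ck_on_def
  proof (intro allI impI)
    fix ms assume ms: "set ms \<subseteq> {..<n}" "enat (length ms) \<le> enat (Suc k)"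
    show "pdw_exists U ms f \<and> continuous_on U (pdw ms f)"
    proof (cases ms rule: rev_cases)
      case Nil
      then show ?thesis using f by simp
    next
      case (snoc ms' m)
      then have "m < n" "set ms' \<subseteq> {..<n}" "enat (length ms') \<le> enat k" using ms by auto
      then show ?thesis
        using f unfolding snoc pdw_append pdw_exists_append Ck_on_def partially_differentiable_def
        by blast
    qed
  qed
qed

lemma Ck_on_0: "Ck_on n (enat 0) U f \<longleftrightarrow> continuous_on U f"
  by (auto simp: Ck_on_def)

lemma pdw_exists_pointwise: "pdw_exists U ms f \<longleftrightarrow> (\<forall>x\<in>U. pdw_exists {x} ms f)"
  by (induction ms) auto

lemma Ck_on_subset: "Ck_on n k U f \<Longrightarrow> V \<subseteq> U \<Longrightarrow> Ck_on n k V f"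
  unfolding Ck_on_def using pdw_exists_pointwise continuous_on_subset by (metis subsetD)

lemma continuous_on_locally:
  fixes f :: fn
  assumes "\<And>x. x \<in> U \<Longrightarrow> \<exists>V\<in>opens n. x \<in> V \<and> V \<subseteq> U \<and> continuous_on V f" "U \<subseteq> Rn n"
  shows "continuous_on U f"
  unfolding continuous_on_eq_continuous_within
proof
  fix x assume "x \<in> U"
  then obtain V where V: "V \<in> opens n" "x \<in> V" "V \<subseteq> U" "continuous_on V f"
    using assms(1) by blast
  then obtain T where T: "open T" "V = Rn n \<inter> T"
    by (auto simp: opens_eq_openin_Rn openin_open)
  have "at x within U = at x within V"
    by (rule at_within_nhd[of x T]) (use T V assms(2) in auto)
  then show "continuous (at x within U) f"
    using V by (simp add: continuous_on_eq_continuous_within continuous_within)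
qed

lemma Ck_on_locally:
  assumes "\<And>x. x \<in> U \<Longrightarrow> \<exists>V\<in>opens n. x \<in> V \<and> V \<subseteq> U \<and> Ck_on n k V f" "U \<subseteq> Rn n"
  shows "Ck_on n k U f"
  unfolding Ck_on_def
proof (intro allI impI conjI)
  fix ms assume ms: "set ms \<subseteq> {..<n}" "enat (length ms) \<le> k"
  show "pdw_exists U ms f"
    unfolding pdw_exists_pointwise[of U]
  proof
    fix x assume "x \<in> U"
    then obtain V where "x \<in> V" "Ck_on n k V f" using assms(1) by blast
    then show "pdw_exists {x} ms f"
      using ms pdw_exists_pointwise[of V] unfolding Ck_on_def by blast
  qed
  show "continuous_on U (pdw ms f)"
  proof (rule continuous_on_locally[OF _ assms(2)])
    fix x assume "x \<in> U"
    then obtain V where V: "V \<in> opens n" "x \<in> V" "V \<subseteq> U" "Ck_on n k V f"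
      using assms(1) by blast
    moreover have "continuous_on V (pdw ms f)" using V(4) ms unfolding Ck_on_def by blast
    ultimately show "\<exists>V\<in>opens n. x \<in> V \<and> V \<subseteq> U \<and> continuous_on V (pdw ms f)" by blast
  qed
qed

lemma partial_derivative_cong:
  assumes "U \<in> opens n" "x \<in> U" "m < n" "\<And>x. x \<in> U \<Longrightarrow> f x = g x"
  shows "((\<lambda>t. f (x(m := t))) has_field_derivative d) (at (x m)) \<longleftrightarrow>
         ((\<lambda>t. g (x(m := t))) has_field_derivative d) (at (x m))"
proof (rule DERIV_cong_ev[OF refl _ refl])
  show "\<forall>\<^sub>F t in nhds (x m). f (x(m := t)) = g (x(m := t))"
    using eventually_fun_upd_in_opens[OF assms(1-3)] by (rule eventually_mono) (rule assms(4))
qed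

text \<open>Being of class \<open>C\<^sup>k\<close> on an open set depends only on the values there. This is what makes
  extensional maps, arbitrary outside their domain, harmless for differentiation.\<close>

lemma Ck_on_cong:
  assumes U: "U \<in> opens n" and eq: "\<And>x. x \<in> U \<Longrightarrow> f x = g x"
  shows "Ck_on n k U f \<longleftrightarrow> Ck_on n k U g"
proof -
  have imp: "Ck_on n (enat j) U g"
    if "Ck_on n (enat j) U f" "\<And>x. x \<in> U \<Longrightarrow> f x = g x" for j and f g :: fn
    using that
  proof (induction j arbitrary: f g)
    case 0
    then show ?case by (simp add: Ck_on_0 cong: continuous_on_cong)
  next
    case (Suc j)
    have cong: "((\<lambda>t. f (x(m := t))) has_field_derivative d) (at (x m)) \<longleftrightarrow>
         ((\<lambda>t. g (x(m := t))) has_field_derivative d) (at (x m))" if "x \<in> U" "m < n" for x m d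
      using U that Suc.prems(2) by (rule partial_derivative_cong)
    have "partially_differentiable n U f" using Suc.prems(1) by (simp add: Ck_on_Suc)
    with cong have "partially_differentiable n U g"
      unfolding partially_differentiable_def field_differentiable_def by blast
    moreover have "pd1 m f x = pd1 m g x" if "x \<in> U" "m < n" for m x
      unfolding pd1_def deriv_def cong[OF that] ..
    then have "Ck_on n (enat j) U (pd1 m g)" if "m < n" for m
      using Suc.IH[of "pd1 m f" "pd1 m g"] Suc.prems(1) that by (auto simp: Ck_on_Suc)
    moreover have "continuous_on U g"
      using Suc.prems by (simp add: Ck_on_Suc cong: continuous_on_cong)
    ultimately show ?case by (simp add: Ck_on_Suc)
  qed
  show ?thesis
  proof
    assume "Ck_on n k U f"
    from imp[OF Ck_on_mono[OF this] eq] show "Ck_on n k U g" by (rule Ck_onI_finite)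
  next
    assume "Ck_on n k U g"
    from imp[OF Ck_on_mono[OF this] eq[symmetric]] show "Ck_on n k U f" by (rule Ck_onI_finite)
  qed
qed

lemma Ck_on_const: "Ck_on n k U (\<lambda>x. c)"
proof (rule Ck_onI_finite)
  fix j
  show "Ck_on n (enat j) U (\<lambda>x. c)"
  proof (induction j arbitrary: c)
    case (Suc j)
    moreover have "pd1 m (\<lambda>x. c) = (\<lambda>x. 0)" for m by (simp add: pd1_def fun_eq_iff)
    ultimately show ?case by (simp add: Ck_on_Suc partially_differentiable_def)
  qed (simp add: Ck_on_0)
qed

lemma Ck_on_coordinate: "Ck_on n k U (\<lambda>x. x j)"
proof (rule Ck_onI_finite)
  fix i
  have cont: "continuous_on U (\<lambda>x. x j)" for U :: "pt set"
    by (rule continuous_on_product_then_coordinatewise) (rule continuous_on_id)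
  have der: "((\<lambda>t. (x(m := t)) j) has_field_derivative (if m = j then 1 else 0)) (at (x m))"
    for m and x :: pt by simp
  show "Ck_on n (enat i) U (\<lambda>x. x j)"
  proof (cases i)
    case (Suc i')
    have "pd1 m (\<lambda>x. x j) = (\<lambda>x. if m = j then 1 else 0)" for m
      by (rule ext, rule pd1_eqI, rule der)
    moreover have "partially_differentiable n U (\<lambda>x. x j)"
      using der unfolding partially_differentiable_def field_differentiable_def by blast
    ultimately show ?thesis by (simp add: Suc Ck_on_Suc cont Ck_on_const)
  qed (simp add: Ck_on_0 cont)
qed

text \<open>Only the values of the partial derivatives on \<open>U\<close> matter, so they may be given by the formulas
  that differentiation rules produce.\<close>

lemma Ck_on_SucI:
  assumes U: "U \<in> opens n" and "continuous_on U f"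
    and der: "\<And>m x. m < n \<Longrightarrow> x \<in> U \<Longrightarrow>
      ((\<lambda>t. f (x(m := t))) has_field_derivative f' m x) (at (x m))"
    and "\<And>m. m < n \<Longrightarrow> Ck_on n (enat k) U (f' m)"
  shows "Ck_on n (enat (Suc k)) U f"
proof -
  have "partially_differentiable n U f"
    using der unfolding partially_differentiable_def field_differentiable_def by blast
  moreover have "Ck_on n (enat k) U (pd1 m f)" if "m < n" for m
  proof -
    have "pd1 m f x = f' m x" if "x \<in> U" for x
      by (rule pd1_eqI, rule der) (use \<open>m < n\<close> that in auto)
    then show ?thesis
      using assms(4)[OF that] Ck_on_cong[OF U, of "pd1 m f" "f' m"] by blast
  qed
  ultimately show ?thesis using assms(2) by (simp add: Ck_on_Suc)
qed

lemma Ck_on_SucD: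
  assumes "Ck_on n (enat (Suc k)) U f"
  shows "continuous_on U f" "partially_differentiable n U f"
    "m < n \<Longrightarrow> Ck_on n (enat k) U (pd1 m f)" "Ck_on n (enat k) U f"
  using assms Ck_on_mono[OF assms, of "enat k"] by (auto simp: Ck_on_Suc)

lemma Ck_on_add:
  assumes "U \<in> opens n" "Ck_on n (enat k) U f" "Ck_on n (enat k) U g"
  shows "Ck_on n (enat k) U (\<lambda>x. f x + g x)"
  using assms(2,3)
proof (induction k arbitrary: f g)
  case 0
  then show ?case by (auto simp: Ck_on_0 intro: continuous_intros)
next
  case (Suc k)
  note f = Ck_on_SucD[OF Suc.prems(1)] and g = Ck_on_SucD[OF Suc.prems(2)]
  show ?case
  proof (rule Ck_on_SucI[OF assms(1), where f' = "\<lambda>m x. pd1 m f x + pd1 m g x"])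
    show "continuous_on U (\<lambda>x. f x + g x)" using f(1) g(1) by (rule continuous_on_add)
    show "Ck_on n (enat k) U (\<lambda>x. pd1 m f x + pd1 m g x)" if "m < n" for m
      using f(3)[OF that] g(3)[OF that] by (rule Suc.IH)
    fix m x assume "m < n" "x \<in> U"
    from DERIV_add[OF has_partial_derivative[OF f(2) this] has_partial_derivative[OF g(2) this]]
    show "((\<lambda>t. f (x(m := t)) + g (x(m := t))) has_field_derivative
        pd1 m f x + pd1 m g x) (at (x m))" .
  qed
qed

lemma Ck_on_mult:
  assumes "U \<in> opens n" "Ck_on n (enat k) U f" "Ck_on n (enat k) U g"
  shows "Ck_on n (enat k) U (\<lambda>x. f x * g x)"
  using assms(2,3)
proof (induction k arbitrary: f g)
  case 0
  then show ?case by (auto simp: Ck_on_0 intro: continuous_intros)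
next
  case (Suc k)
  note f = Ck_on_SucD[OF Suc.prems(1)] and g = Ck_on_SucD[OF Suc.prems(2)]
  show ?case
  proof (rule Ck_on_SucI[OF assms(1), where f' = "\<lambda>m x. pd1 m f x * g x + pd1 m g x * f x"])
    show "continuous_on U (\<lambda>x. f x * g x)" using f(1) g(1) by (rule continuous_on_mult)
    show "Ck_on n (enat k) U (\<lambda>x. pd1 m f x * g x + pd1 m g x * f x)" if "m < n" for m
      using Suc.IH f(3,4) g(3,4) that by (intro Ck_on_add assms(1)) blast+
    fix m x assume "m < n" "x \<in> U"
    from DERIV_mult[OF has_partial_derivative[OF f(2) this] has_partial_derivative[OF g(2) this]]
    show "((\<lambda>t. f (x(m := t)) * g (x(m := t))) has_real_derivative
        pd1 m f x * g x + pd1 m g x * f x) (at (x m))" unfolding fun_upd_triv .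
  qed
qed

lemma Ck_on_sum:
  assumes "U \<in> opens n" "\<And>i. i < (N :: nat) \<Longrightarrow> Ck_on n (enat k) U (f i)"
  shows "Ck_on n (enat k) U (\<lambda>x. \<Sum>i<N. f i x)"
  using assms(2) by (induction N) (auto simp: Ck_on_const intro!: Ck_on_add[OF assms(1)])

text \<open>By the chain rule the partial derivatives of \<open>f \<circ> g\<close> are sums of products of functions
  \<open>\<partial>\<^sub>j f \<circ> g\<close>, to which the induction hypothesis applies, with partial derivatives of \<open>g\<close>. Hence the
  induction on the order is for all \<open>f\<close> at once, with \<open>g\<close> fixed.\<close>

lemma Ck_on_compose:
  fixes g :: "pt \<Rightarrow> pt"
  assumes U: "U \<in> opens n" and V: "V \<in> opens n" and gV: "g ` U \<subseteq> V"
    and f: "Ck_on n k V f" and g: "\<And>j. j < n \<Longrightarrow> Ck_on n k U (\<lambda>x. g x j)"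
  shows "Ck_on n k U (\<lambda>x. f (g x))"
proof (rule Ck_onI_finite)
  fix i assume i: "enat i \<le> k"
  have "continuous_on U (\<lambda>x. g x j)" for j
  proof (cases "j < n")
    case True
    then show ?thesis using g Ck_on_imp_continuous_on by blast
  next
    case False
    then have "g x j = 0" if "x \<in> U" for x
      using that gV opens_subset_Rn[OF V] Rn_coord[of "g x" n j] by auto
    then show ?thesis by (simp cong: continuous_on_cong)
  qed
  then have cont: "continuous_on U g" by (rule continuous_on_coordinatewise_then_product)
  have "Ck_on n (enat i) U (\<lambda>x. f (g x))"
    if "Ck_on n (enat i) V f" "\<And>j. j < n \<Longrightarrow> Ck_on n (enat i) U (\<lambda>x. g x j)"
    using that
  proof (induction i arbitrary: f)
    case 0
    then have "continuous_on V f" by (simp add: Ck_on_0)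
    then show ?case
      unfolding Ck_on_0 by (rule continuous_on_compose2[OF _ cont gV])
  next
    case (Suc i)
    note f = Ck_on_SucD[OF Suc.prems(1)] and g = Ck_on_SucD[OF Suc.prems(2)]
    show ?case
    proof (rule Ck_on_SucI[OF U, where f' = "\<lambda>m x. \<Sum>j<n. pd1 j f (g x) * pd1 m (\<lambda>x. g x j) x"])
      show "continuous_on U (\<lambda>x. f (g x))" by (rule continuous_on_compose2[OF f(1) cont gV])
      show "Ck_on n (enat i) U (\<lambda>x. \<Sum>j<n. pd1 j f (g x) * pd1 m (\<lambda>x. g x j) x)" if "m < n" for m
        using Suc.IH[OF f(3)] g(3,4) that by (intro Ck_on_sum Ck_on_mult U) blast+
      fix m x assume mx: "m < n" "x \<in> U"
      have ev: "\<forall>\<^sub>F t in nhds (x m). g (x(m := t)) \<in> V"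
        using eventually_fun_upd_in_opens[OF U mx(2,1)] gV by (auto elim!: eventually_mono)
      have "((\<lambda>t. f (g (x(m := t)))) has_field_derivative
          (\<Sum>j<n. pd1 j f (g (x(m := x m))) * pd1 m (\<lambda>x. g x j) x)) (at (x m))"
      proof (rule chain_rule_curve[OF V f(2) _ _ ev])
        show "continuous_on V (pd1 j f)" if "j < n" for j
          using f(3)[OF that] by (rule Ck_on_imp_continuous_on)
        show "g (x(m := x m)) \<in> V" unfolding fun_upd_triv using mx gV by blast
        show "((\<lambda>t. g (x(m := t)) j) has_field_derivative pd1 m (\<lambda>x. g x j) x) (at (x m))"
          if "j < n" for j
          using has_partial_derivative[OF g(2)[OF that] mx] .
      qed
      then show "((\<lambda>t. f (g (x(m := t)))) has_field_derivative
          (\<Sum>j<n. pd1 j f (g x) * pd1 m (\<lambda>x. g x j) x)) (at (x m))"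
        unfolding fun_upd_triv .
    qed
  qed
  then show "Ck_on n (enat i) U (\<lambda>x. f (g x))"
    using f g i Ck_on_mono by blast
qed

section \<open>Maps of class \<open>C\<^sup>k\<close> between open sets\<close>

lemma CkM_compose:
  assumes "U \<in> opens n" "V \<in> opens n" "f \<in> CkM n k U" "f ` U \<subseteq> V" "g \<in> CkM n k V"
  shows "compose U g f \<in> CkM n k U"
proof -
  have "Ck_on n k U (\<lambda>x. compose U g f x j)" if "j < n" for j
  proof -
    have "Ck_on n k U (\<lambda>x. g (f x) j)"
      by (rule Ck_on_compose[OF assms(1,2,4)]) (use assms(3,5) that in \<open>simp_all add: CkM_def\<close>)
    then show ?thesis
      by (rule Ck_on_cong[OF assms(1), THEN iffD1, rotated]) (simp add: compose_eq)
  qed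
  moreover have "compose U g f ` U \<subseteq> Rn n"
    using assms(4,5) by (simp add: CkM_def compose_eq image_subset_iff)
  ultimately show ?thesis by (simp add: CkM_def)
qed

lemma Ck_maps_compose:
  assumes "U \<in> opens n" "V \<in> opens n" "f \<in> Ck_maps n k U V" "g \<in> Ck_maps n k V W"
  shows "compose U g f \<in> Ck_maps n k U W"
proof -
  have "compose U g f \<in> CkM n k U"
    using assms by (intro CkM_compose[of U n V]) (simp_all add: Ck_maps_def)
  moreover have "compose U g f ` U \<subseteq> W"
    using assms(3,4) by (simp add: Ck_maps_def compose_eq image_subset_iff)
  ultimately show ?thesis by (simp add: Ck_maps_def)
qed

lemma CkM_restrict:
  assumes "V \<in> opens n" "V \<subseteq> U" "f \<in> CkM n k U"
  shows "restrict f V \<in> CkM n k V"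
proof -
  have "Ck_on n k V (\<lambda>x. restrict f V x j)" if "j < n" for j
  proof -
    have "Ck_on n k V (\<lambda>x. f x j)"
      by (rule Ck_on_subset[OF _ assms(2)]) (use assms(3) that in \<open>simp add: CkM_def\<close>)
    then show ?thesis
      using Ck_on_cong[OF assms(1), of "\<lambda>x. restrict f V x j" "\<lambda>x. f x j"] by simp
  qed
  moreover have "restrict f V ` V \<subseteq> Rn n"
    using assms(2,3) unfolding CkM_def by auto
  ultimately show ?thesis by (simp add: CkM_def)
qed

text \<open>For composites of maps between manifolds: their representatives in charts factor through a chart
  of the middle manifold only locally.\<close>

lemma CkM_locally:
  assumes "U \<in> opens n" "f \<in> extensional U"
    and "\<And>x. x \<in> U \<Longrightarrow> \<exists>V\<in>opens n. x \<in> V \<and> V \<subseteq> U \<and> restrict f V \<in> CkM n k V"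
  shows "f \<in> CkM n k U"
proof -
  have "Ck_on n k U (\<lambda>x. f x j)" if "j < n" for j
  proof (rule Ck_on_locally[OF _ opens_subset_Rn[OF assms(1)]])
    fix x assume "x \<in> U"
    then obtain V where V: "V \<in> opens n" "x \<in> V" "V \<subseteq> U" "restrict f V \<in> CkM n k V"
      using assms(3) by blast
    then have "Ck_on n k V (\<lambda>x. f x j)"
      using Ck_on_cong[OF V(1), of "\<lambda>x. f x j" "\<lambda>x. restrict f V x j" k] that
      by (simp only: CkM_def mem_Collect_eq restrict_apply' simp_thms)
    with V show "\<exists>V\<in>opens n. x \<in> V \<and> V \<subseteq> U \<and> Ck_on n k V (\<lambda>x. f x j)" by blast
  qed
  moreover have "f x \<in> Rn n" if x: "x \<in> U" for x
  proof -
    obtain V where "x \<in> V" "restrict f V \<in> CkM n k V" using assms(3)[OF x] by blast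
    then show ?thesis by (auto simp: CkM_def image_subset_iff)
  qed
  ultimately show ?thesis using assms(2) by (auto simp: CkM_def)
qed

lemma id_in_Ck_diffeos:
  assumes "U \<in> opens n"
  shows "(\<lambda>x\<in>U. x) \<in> Ck_diffeos n k U U"
proof -
  have "Ck_on n k U (\<lambda>x. (\<lambda>x\<in>U. x) x j)" for j
    using Ck_on_cong[OF assms, of "\<lambda>x. (\<lambda>x\<in>U. x) x j" "\<lambda>x. x j"] by (simp add: Ck_on_coordinate)
  then have id: "(\<lambda>x\<in>U. x) \<in> Ck_maps n k U U"
    using opens_subset_Rn[OF assms] by (auto simp: Ck_maps_def CkM_def)
  have inj: "inj_on (\<lambda>x\<in>U. x) U" by (simp add: inj_on_def)
  have "restrict (inv_into U (\<lambda>x\<in>U. x)) U = (\<lambda>x\<in>U. x)"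
    using inv_into_f_f[OF inj] by (auto simp: fun_eq_iff)
  then show ?thesis
    using id inj by (simp add: Ck_diffeos_def bij_betw_def)
qed

section \<open>Charts\<close>

lemma is_chartD:
  assumes "is_chart n M c"
  shows "openin M (fst c)" "fst c \<subseteq> topspace M" "snd c \<in> extensional (fst c)"
    "inj_on (snd c) (fst c)" "snd c ` fst c \<in> opens n"
    "homeomorphic_map (subtopology M (fst c)) (subtopology (Euclidean_space n) (snd c ` fst c)) (snd c)"
proof -
  show op: "openin M (fst c)" and "snd c \<in> extensional (fst c)" "snd c ` fst c \<in> opens n"
    and h: "homeomorphic_map (subtopology M (fst c)) (subtopology (Euclidean_space n) (snd c ` fst c)) (snd c)"
    using assms by (auto simp: is_chart_def split: prod.splits)
  show sub: "fst c \<subseteq> topspace M" using op by (rule openin_subset)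
  have "topspace (subtopology M (fst c)) = fst c" using sub by (auto simp: topspace_subtopology)
  then show "inj_on (snd c) (fst c)" using homeomorphic_imp_injective_map[OF h] by simp
qed

lemma chart_image_open:
  assumes c: "is_chart n M c" and T: "openin M T" "T \<subseteq> fst c"
  shows "snd c ` T \<in> opens n"
proof -
  have "openin (subtopology M (fst c)) T" using T by (auto simp: openin_subtopology)
  then have "openin (subtopology (Euclidean_space n) (snd c ` fst c)) (snd c ` T)"
    using homeomorphic_imp_open_map[OF is_chartD(6)[OF c]] by (simp add: open_map_def)
  then show ?thesis
    using is_chartD(5)[OF c] by (simp add: opens_def openin_open_subtopology)
qed

lemma rep_dom_open:
  assumes "is_chart n M c" "openin N (fst c')" "continuous_map M N f"
  shows "rep_dom c f c' \<in> opens n"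
proof -
  have "openin M (fst c \<inter> {x \<in> topspace M. f x \<in> fst c'})"
    using is_chartD(1)[OF assms(1)] openin_continuous_map_preimage[OF assms(3,2)] by (rule openin_Int)
  then have "snd c ` (fst c \<inter> {x \<in> topspace M. f x \<in> fst c'}) \<in> opens n"
    by (rule chart_image_open[OF assms(1)]) simp
  moreover have "fst c \<inter> {x \<in> topspace M. f x \<in> fst c'} = {x \<in> fst c. f x \<in> fst c'}"
    using is_chartD(2)[OF assms(1)] by auto
  ultimately show ?thesis by (simp add: rep_dom_def)
qed

lemma trans_dom_open:
  assumes "is_chart n M c" "is_chart n M c'"
  shows "trans_dom c c' \<in> opens n"
  using rep_dom_open[OF assms(1) is_chartD(1)[OF assms(2)], of "\<lambda>x. x"] by simp

lemma local_rep_apply: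
  assumes "inj_on (snd c) (fst c)" "x \<in> fst c" "f x \<in> fst c'"
  shows "local_rep c f c' (snd c x) = snd c' (f x)"
  using assms by (auto simp: local_rep_def rep_dom_def)

lemma local_rep_cong:
  assumes "inj_on (snd c) (fst c)" "\<And>x. x \<in> fst c \<Longrightarrow> f x = g x"
  shows "rep_dom c f c' = rep_dom c g c'" "local_rep c f c' = local_rep c g c'"
proof -
  have *: "{x \<in> fst c. f x \<in> fst c'} = {x \<in> fst c. g x \<in> fst c'}" using assms(2) by auto
  show dom: "rep_dom c f c' = rep_dom c g c'" unfolding rep_dom_def * ..
  show "local_rep c f c' = local_rep c g c'"
    unfolding local_rep_def dom
    by (rule restrict_ext) (use assms in \<open>auto simp: rep_dom_def\<close>)
qed

definition restrict_chart :: "'m chart \<Rightarrow> 'm set \<Rightarrow> 'm chart" where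
  "restrict_chart c T = (T, restrict (snd c) T)"

lemma fst_restrict_chart [simp]: "fst (restrict_chart c T) = T"
  by (simp add: restrict_chart_def)

lemma restrict_chart_self: "is_chart n M c \<Longrightarrow> restrict_chart c (fst c) = c"
  using is_chartD(3)[of n M c] by (simp add: restrict_chart_def extensional_restrict)

lemma is_chart_restrict:
  assumes c: "is_chart n M c" and T: "openin M T" "T \<subseteq> fst c"
  shows "is_chart n M (restrict_chart c T)"
proof -
  have "homeomorphic_map (subtopology (subtopology M (fst c)) T)
      (subtopology (subtopology (Euclidean_space n) (snd c ` fst c)) (snd c ` T)) (snd c)"
    using T is_chartD(2,5)[OF c] opens_subset_Rn[OF is_chartD(5)[OF c]]
    by (intro homeomorphic_map_subtopologies[OF is_chartD(6)[OF c]]) auto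
  moreover have "fst c \<inter> T = T" "snd c ` fst c \<inter> snd c ` T = snd c ` T" using T(2) by auto
  ultimately have h: "homeomorphic_map (subtopology M T)
      (subtopology (Euclidean_space n) (snd c ` T)) (snd c)"
    by (simp add: subtopology_subtopology)
  have "homeomorphic_map (subtopology M T)
      (subtopology (Euclidean_space n) (snd c ` T)) (restrict (snd c) T)"
    by (rule homeomorphic_map_eq[OF h]) simp
  moreover have "restrict (snd c) T ` T = snd c ` T" by auto
  ultimately show ?thesis
    using T(1) chart_image_open[OF assms] by (simp add: is_chart_def restrict_chart_def)
qed

lemma local_rep_restrict_chart:
  fixes c c' :: "'m chart" and f :: "'m \<Rightarrow> 'm"
  assumes "inj_on (snd c) (fst c)" "T \<subseteq> fst c" "T' \<subseteq> fst c'"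
  defines "R \<equiv> rep_dom (restrict_chart c T) f (restrict_chart c' T')"
  shows "R \<subseteq> rep_dom c f c'"
    "local_rep (restrict_chart c T) f (restrict_chart c' T') = restrict (local_rep c f c') R"
proof -
  have R: "R = snd c ` {x \<in> T. f x \<in> T'}"
    unfolding R_def rep_dom_def restrict_chart_def by auto
  show "R \<subseteq> rep_dom c f c'" unfolding R rep_dom_def using assms(2,3) by auto
  have inj: "inj_on (restrict (snd c) T) T"
    using inj_on_subset[OF assms(1,2)] by (simp add: inj_on_def)
  show "local_rep (restrict_chart c T) f (restrict_chart c' T') = restrict (local_rep c f c') R"
  proof
    fix p
    show "local_rep (restrict_chart c T) f (restrict_chart c' T') p = restrict (local_rep c f c') R p"
    proof (cases "p \<in> R")
      case False
      then show ?thesis by (simp add: local_rep_def R_def)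
    next
      case True
      then obtain x where x: "x \<in> T" "f x \<in> T'" "p = snd c x" using R by auto
      have "local_rep (restrict_chart c T) f (restrict_chart c' T') (snd (restrict_chart c T) x) =
          snd (restrict_chart c' T') (f x)"
        by (rule local_rep_apply) (use x inj in \<open>simp_all add: restrict_chart_def\<close>)
      moreover have "local_rep c f c' (snd c x) = snd c' (f x)"
        by (rule local_rep_apply) (use x assms in auto)
      ultimately show ?thesis using True x by (simp add: restrict_chart_def)
    qed
  qed
qed

section \<open>Atlases\<close>

lemma Ck_manifoldD:
  assumes "Ck_manifold n k X"
  shows "c \<in> snd X \<Longrightarrow> is_chart n (fst X) c" "\<Union>(fst ` snd X) = topspace (fst X)"
    "c \<in> snd X \<Longrightarrow> c' \<in> snd X \<Longrightarrow> transition c c' \<in> CkM n k (trans_dom c c')"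
    "Ck_atlas n k (fst X) \<A>' \<Longrightarrow> snd X \<subseteq> \<A>' \<Longrightarrow> \<A>' = snd X"
  using assms by (auto simp: Ck_manifold_def Ck_atlas_def split: prod.splits)

text \<open>Adding the restricted chart to the atlas keeps all transition maps of class \<open>C\<^sup>k\<close>, as these are
  restrictions of transition maps of the atlas; so maximality applies.\<close>

lemma restrict_chart_in_atlas:
  assumes X: "Ck_manifold n k X" and c: "c \<in> snd X" and T: "openin (fst X) T" "T \<subseteq> fst c"
  shows "restrict_chart c T \<in> snd X"
proof -
  let ?A = "insert (restrict_chart c T) (snd X)"
  \<comment> \<open>viewing all charts of the larger atlas as restrictions avoids a case distinction\<close>
  have restr: "\<exists>e\<in>snd X. \<exists>P. openin (fst X) P \<and> P \<subseteq> fst e \<and> d = restrict_chart e P" if "d \<in> ?A" for d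
  proof (cases "d = restrict_chart c T")
    case True
    then show ?thesis using c T by blast
  next
    case False
    then have "d \<in> snd X" using that by simp
    moreover have "is_chart n (fst X) d" using Ck_manifoldD(1)[OF X \<open>d \<in> snd X\<close>] .
    ultimately show ?thesis
      using restrict_chart_self is_chartD(1) by (metis order_refl)
  qed
  have charts: "is_chart n (fst X) d" if "d \<in> ?A" for d
    using that Ck_manifoldD(1)[OF X] is_chart_restrict[OF Ck_manifoldD(1)[OF X c] T] by blast
  have "Ck_atlas n k (fst X) ?A"
    unfolding Ck_atlas_def
  proof (intro conjI ballI)
    show "is_chart n (fst X) d" if "d \<in> ?A" for d using that by (rule charts)
    show "\<Union>(fst ` ?A) = topspace (fst X)"
      using Ck_manifoldD(2)[OF X] openin_subset[OF T(1)] by auto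
    fix d d' assume d: "d \<in> ?A" "d' \<in> ?A"
    obtain e P where e: "e \<in> snd X" "P \<subseteq> fst e" "d = restrict_chart e P" using restr[OF d(1)] by blast
    obtain e' P' where e': "e' \<in> snd X" "P' \<subseteq> fst e'" "d' = restrict_chart e' P'"
      using restr[OF d(2)] by blast
    note rep = local_rep_restrict_chart[OF is_chartD(4)[OF Ck_manifoldD(1)[OF X e(1)]] e(2) e'(2),
        where f = "\<lambda>x. x", folded e(3) e'(3)]
    show "transition d d' \<in> CkM n k (trans_dom d d')"
      unfolding rep(2)
      using trans_dom_open[OF charts charts, OF d] rep(1) Ck_manifoldD(3)[OF X e(1) e'(1)]
      by (rule CkM_restrict)
  qed
  then have "?A = snd X" by (rule Ck_manifoldD(4)[OF X]) auto
  then show ?thesis by auto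
qed

lemma transition_in_Ck_diffeos:
  assumes X: "Ck_manifold n k X" and c: "c \<in> snd X" "c' \<in> snd X"
  shows "transition c c' \<in> Ck_diffeos n k (trans_dom c c') (trans_dom c' c)"
proof -
  note chart = Ck_manifoldD(1)[OF X c(1)] Ck_manifoldD(1)[OF X c(2)]
  have inj: "inj_on (snd c) (fst c)" "inj_on (snd c') (fst c')" by (fact chart[THEN is_chartD(4)])+
  let ?I = "fst c \<inter> fst c'"
  have dom: "trans_dom c c' = snd c ` ?I" "trans_dom c' c = snd c' ` ?I"
    by (auto simp: rep_dom_def)
  have val: "transition c c' (snd c x) = snd c' x" "transition c' c (snd c' x) = snd c x" if "x \<in> ?I" for x
    using local_rep_apply[of c x "\<lambda>x. x" c'] local_rep_apply[of c' x "\<lambda>x. x" c] inj that by auto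
  have maps: "transition c c' \<in> Ck_maps n k (trans_dom c c') (trans_dom c' c)"
    "transition c' c \<in> Ck_maps n k (trans_dom c' c) (trans_dom c c')"
  proof -
    have "transition c c' ` trans_dom c c' \<subseteq> trans_dom c' c" "transition c' c ` trans_dom c' c \<subseteq> trans_dom c c'"
      unfolding dom using val by auto
    then show "transition c c' \<in> Ck_maps n k (trans_dom c c') (trans_dom c' c)"
      "transition c' c \<in> Ck_maps n k (trans_dom c' c) (trans_dom c c')"
      using Ck_manifoldD(3)[OF X c] Ck_manifoldD(3)[OF X c(2,1)] by (simp_all add: Ck_maps_def)
  qed
  have bij: "bij_betw (transition c c') (trans_dom c c') (trans_dom c' c)"
    unfolding dom
    by (rule bij_betw_byWitness[where f' = "transition c' c"]) (use val in auto)
  have "restrict (inv_into (trans_dom c c') (transition c c')) (trans_dom c' c) = transition c' c"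
  proof
    fix q
    show "restrict (inv_into (trans_dom c c') (transition c c')) (trans_dom c' c) q = transition c' c q"
    proof (cases "q \<in> trans_dom c' c")
      case True
      then obtain x where x: "x \<in> ?I" "q = snd c' x" using dom(2) by auto
      have "inv_into (trans_dom c c') (transition c c') (transition c c' (snd c x)) = snd c x"
        using bij x dom(1) by (intro inv_into_f_f) (auto simp: bij_betw_def)
      then show ?thesis using True x val by simp
    qed (simp add: local_rep_def)
  qed
  then show ?thesis using maps bij by (simp add: Ck_diffeos_def)
qed

section \<open>Maps of class \<open>C\<^sup>k\<close> between manifolds\<close>

lemma Ck_mfd_map_funcset: "Ck_mfd_map n k X Y f \<Longrightarrow> f \<in> topspace (fst X) \<rightarrow> topspace (fst Y)"
  by (auto simp: Ck_mfd_map_def continuous_map_def)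

lemma Ck_mfd_map_extensional: "Ck_mfd_map n k X Y f \<Longrightarrow> f \<in> extensional (topspace (fst X))"
  by (simp add: Ck_mfd_map_def)

lemma Ck_mfd_map_id:
  assumes "Ck_manifold n k X"
  shows "Ck_mfd_map n k X X (\<lambda>x\<in>topspace (fst X). x)"
  unfolding Ck_mfd_map_def
proof (intro conjI ballI)
  show "continuous_map (fst X) (fst X) (\<lambda>x\<in>topspace (fst X). x)"
    by (rule continuous_map_eq[OF continuous_map_id]) simp
  fix c c' assume c: "c \<in> snd X" "c' \<in> snd X"
  have chart: "is_chart n (fst X) c" using Ck_manifoldD(1)[OF assms c(1)] .
  have eq: "(\<lambda>x\<in>topspace (fst X). x) x = x" if "x \<in> fst c" for x
    using that is_chartD(2)[OF chart] by auto
  show "local_rep c (\<lambda>x\<in>topspace (fst X). x) c' \<in> CkM n k (rep_dom c (\<lambda>x\<in>topspace (fst X). x) c')"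
    using local_rep_cong[of c "\<lambda>x\<in>topspace (fst X). x" "\<lambda>x. x" c', OF is_chartD(4)[OF chart] eq]
      Ck_manifoldD(3)[OF assms c] by simp
qed simp

text \<open>Around a point \<open>x\<close> of the domain one chooses a chart \<open>c'\<close> of the middle manifold at \<open>f x\<close>. On
  the points \<open>T\<close> that stay in the domains of all three charts, the representative of the composite
  is the composite of the representatives.\<close>

lemma Ck_mfd_map_compose:
  assumes X: "Ck_manifold n k X" and Y: "Ck_manifold n k Y" and Z: "Ck_manifold n k Z"
    and f: "Ck_mfd_map n k X Y f" and g: "Ck_mfd_map n k Y Z g"
  shows "Ck_mfd_map n k X Z (compose (topspace (fst X)) g f)"
  unfolding Ck_mfd_map_def
proof (intro conjI ballI)
  let ?h = "compose (topspace (fst X)) g f"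
  have cf: "continuous_map (fst X) (fst Y) f" and cg: "continuous_map (fst Y) (fst Z) g"
    using f g by (auto simp: Ck_mfd_map_def)
  show ch: "continuous_map (fst X) (fst Z) ?h"
    by (rule continuous_map_eq[OF continuous_map_compose[OF cf cg]]) (simp add: compose_eq)
  fix c c'' assume c: "c \<in> snd X" "c'' \<in> snd Z"
  have chart: "is_chart n (fst X) c" "is_chart n (fst Z) c''"
    using Ck_manifoldD(1) X Z c by blast+
  note inj = is_chartD(4)[OF chart(1)]
  have h: "?h x = g (f x)" if "x \<in> fst c" for x
    using that is_chartD(2)[OF chart(1)] by (auto simp: compose_eq)
  show "local_rep c ?h c'' \<in> CkM n k (rep_dom c ?h c'')"
  proof (rule CkM_locally)
    show "rep_dom c ?h c'' \<in> opens n"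
      by (rule rep_dom_open[OF chart(1) is_chartD(1)[OF chart(2)] ch])
    show "local_rep c ?h c'' \<in> extensional (rep_dom c ?h c'')" by (simp add: local_rep_def)
    fix p assume "p \<in> rep_dom c ?h c''"
    then obtain x where x: "x \<in> fst c" "g (f x) \<in> fst c''" "p = snd c x"
      using h by (auto simp: rep_dom_def)
    have "f x \<in> topspace (fst Y)"
      using x(1) is_chartD(2)[OF chart(1)] Ck_mfd_map_funcset[OF f] by auto
    then obtain c' where c': "c' \<in> snd Y" "f x \<in> fst c'"
      using Ck_manifoldD(2)[OF Y] by blast
    have chart': "is_chart n (fst Y) c'" using Ck_manifoldD(1)[OF Y c'(1)] .
    define T where "T = {x \<in> fst c. f x \<in> fst c' \<and> g (f x) \<in> fst c''}"
    have "openin (fst X) (fst c \<inter> {x \<in> topspace (fst X). f x \<in> fst c'} \<inter> {x \<in> topspace (fst X). ?h x \<in> fst c''})"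
      using is_chartD(1)[OF chart(1)] is_chartD(1)[OF chart'] is_chartD(1)[OF chart(2)] cf ch
      by (intro openin_Int openin_continuous_map_preimage)
    moreover have "fst c \<inter> {x \<in> topspace (fst X). f x \<in> fst c'} \<inter> {x \<in> topspace (fst X). ?h x \<in> fst c''} = T"
      unfolding T_def using h is_chartD(2)[OF chart(1)] by auto
    ultimately have T: "openin (fst X) T" by simp
    define V where "V = snd c ` T"
    have V: "V \<in> opens n"
      unfolding V_def by (rule chart_image_open[OF chart(1) T]) (auto simp: T_def)
    let ?f = "restrict (local_rep c f c') V" and ?g = "local_rep c' g c''"
    have fV: "?f (snd c y) = snd c' (f y)" if "y \<in> T" for y
    proof -
      have "snd c y \<in> V" using that by (simp add: V_def)
      then show ?thesis using that local_rep_apply[OF inj, of y f c'] by (simp add: T_def)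
    qed
    have "V \<subseteq> rep_dom c f c'" by (auto simp: V_def T_def rep_dom_def)
    moreover have "local_rep c f c' \<in> CkM n k (rep_dom c f c')"
      using f c(1) c'(1) by (simp add: Ck_mfd_map_def)
    ultimately have "?f \<in> CkM n k V" using V by (intro CkM_restrict)
    moreover have "?f ` V \<subseteq> rep_dom c' g c''"
      unfolding V_def using fV by (auto simp: V_def T_def rep_dom_def)
    moreover have "?g \<in> CkM n k (rep_dom c' g c'')"
      using g c(2) c'(1) by (simp add: Ck_mfd_map_def)
    moreover have "rep_dom c' g c'' \<in> opens n"
      by (rule rep_dom_open[OF chart' is_chartD(1)[OF chart(2)] cg])
    ultimately have comp: "compose V ?g ?f \<in> CkM n k V"
      using V by (intro CkM_compose)
    have "compose V ?g ?f q = local_rep c ?h c'' q" if "q \<in> V" for q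
    proof -
      obtain y where y: "y \<in> T" "q = snd c y" using \<open>q \<in> V\<close> by (auto simp: V_def)
      have "compose V ?g ?f q = ?g (snd c' (f y))" using \<open>q \<in> V\<close> fV[OF y(1)] y(2) by (simp add: compose_eq)
      also have "\<dots> = snd c'' (g (f y))"
        by (rule local_rep_apply) (use y is_chartD(4)[OF chart'] in \<open>auto simp: T_def\<close>)
      also have "\<dots> = local_rep c ?h c'' q"
        using local_rep_apply[OF inj, of y ?h c''] y h by (simp add: T_def)
      finally show ?thesis .
    qed
    then have "compose V ?g ?f = restrict (local_rep c ?h c'') V"
      by (auto simp: fun_eq_iff compose_def)
    moreover have "V \<subseteq> rep_dom c ?h c''" using h by (auto simp: V_def T_def rep_dom_def)
    moreover have "p \<in> V" using x c' by (auto simp: V_def T_def)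
    ultimately show "\<exists>V\<in>opens n. p \<in> V \<and> V \<subseteq> rep_dom c ?h c'' \<and>
        restrict (local_rep c ?h c'') V \<in> CkM n k V"
      using V comp by metis
  qed
qed simp

section \<open>Categories of sets with structure\<close>

text \<open>Both categories of manifolds have as arrows the maps of underlying sets that satisfy some
  condition. Here \<open>P\<close> selects the objects, \<open>H\<close> the admissible maps, and \<open>T\<close> gives the underlying set.\<close>

definition maps_cat :: "('o \<Rightarrow> bool) \<Rightarrow> ('o \<Rightarrow> 'o \<Rightarrow> ('m \<Rightarrow> 'm) \<Rightarrow> bool) \<Rightarrow> ('o \<Rightarrow> 'm set) \<Rightarrow>
    ('o, 'o \<times> 'o \<times> ('m \<Rightarrow> 'm)) cat" where
  "maps_cat P H T = \<lparr>
     Ob = {X. P X},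
     Ar = {(X, Y, f). P X \<and> P Y \<and> H X Y f},
     cDom = fst,
     cCod = (\<lambda>a. fst (snd a)),
     cId = (\<lambda>X. (X, X, \<lambda>x\<in>T X. x)),
     cComp = (\<lambda>(Y, Z, g) (X, Y', f). (X, Z, compose (T X) g f))\<rparr>"

lemma maps_cat_simps:
  "Ob (maps_cat P H T) = {X. P X}"
  "cDom (maps_cat P H T) (X, Y, f) = X"
  "cCod (maps_cat P H T) (X, Y, f) = Y"
  "cId (maps_cat P H T) X = (X, X, \<lambda>x\<in>T X. x)"
  "cComp (maps_cat P H T) (Y, Z, g) (X, Y', f) = (X, Z, compose (T X) g f)"
  "(X, Y, f) \<in> Ar (maps_cat P H T) \<longleftrightarrow> P X \<and> P Y \<and> H X Y f"
  "a \<in> homs (maps_cat P H T) X Y \<longleftrightarrow> (\<exists>f. a = (X, Y, f) \<and> P X \<and> P Y \<and> H X Y f)"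
  by (auto simp: maps_cat_def homs_def)

lemma compose_restrict_id: "compose A (\<lambda>x\<in>A. x) (\<lambda>x\<in>A. x) = (\<lambda>x\<in>A. x)"
  by (simp add: compose_def fun_eq_iff)

text \<open>These are the conditions on the admissible maps under which \<open>maps_cat\<close> is a category. Admissible
  maps are extensional, so that equality of arrows is equality of maps on underlying sets.\<close>

locale map_category =
  fixes P :: "'o \<Rightarrow> bool" and H :: "'o \<Rightarrow> 'o \<Rightarrow> ('m \<Rightarrow> 'm) \<Rightarrow> bool" and T :: "'o \<Rightarrow> 'm set"
  assumes extensional: "P X \<Longrightarrow> P Y \<Longrightarrow> H X Y f \<Longrightarrow> f \<in> extensional (T X)"
    and funcset: "P X \<Longrightarrow> P Y \<Longrightarrow> H X Y f \<Longrightarrow> f \<in> T X \<rightarrow> T Y"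
    and ident: "P X \<Longrightarrow> H X X (\<lambda>x\<in>T X. x)"
    and comp: "P X \<Longrightarrow> P Y \<Longrightarrow> P Z \<Longrightarrow> H X Y f \<Longrightarrow> H Y Z g \<Longrightarrow> H X Z (compose (T X) g f)"
begin

lemma compose_ident:
  assumes "P X" "P Y" "H X Y f"
  shows "compose (T X) f (\<lambda>x\<in>T X. x) = f" "compose (T X) (\<lambda>x\<in>T Y. x) f = f"
  using compose_Id Id_compose funcset[OF assms] extensional[OF assms] by blast+

lemma is_category: "category (maps_cat P H T)"
  unfolding category_def
proof (intro conjI allI ballI impI)
  fix w x y z f g h
  assume "f \<in> homs (maps_cat P H T) w x" "g \<in> homs (maps_cat P H T) x y" "h \<in> homs (maps_cat P H T) y z"
  then obtain f' g' h' where "f = (w, x, f')" "g = (x, y, g')" "h = (y, z, h')" "P w" "P x" "H w x f'"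
    by (auto simp: maps_cat_simps)
  then show "cComp (maps_cat P H T) h (cComp (maps_cat P H T) g f) =
      cComp (maps_cat P H T) (cComp (maps_cat P H T) h g) f"
    using compose_assoc[OF funcset, of w x f'] by (simp add: maps_cat_simps)
qed (auto simp: maps_cat_simps ident compose_ident intro: comp)

end

lemma is_functor_homs:
  "is_functor C D F \<Longrightarrow> f \<in> homs C x y \<Longrightarrow> fa F f \<in> homs D (fo F x) (fo F y)"
  unfolding is_functor_def by blast

lemma is_functor_comp:
  assumes F: "is_functor C D F" and G: "is_functor D E G"
  shows "is_functor C E (func_comp G F)"
  unfolding is_functor_def func_comp_def func.simps
proof (intro conjI ballI allI impI)
  show "category C" "category E" using F G by (simp_all add: is_functor_def)
next
  fix x assume "x \<in> Ob C"
  then show "fo G (fo F x) \<in> Ob E" "fa G (fa F (cId C x)) = cId E (fo G (fo F x))"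
    using F G by (simp_all add: is_functor_def)
next
  fix x y f assume "f \<in> homs C x y"
  then show "fa G (fa F f) \<in> homs E (fo G (fo F x)) (fo G (fo F y))"
    by (intro is_functor_homs[OF G] is_functor_homs[OF F])
next
  fix x y z f g assume fg: "f \<in> homs C x y" "g \<in> homs C y z"
  then have "fa F (cComp C g f) = cComp D (fa F g) (fa F f)"
    using F unfolding is_functor_def by blast
  moreover have "fa G (cComp D (fa F g) (fa F f)) = cComp E (fa G (fa F g)) (fa G (fa F f))"
    using G is_functor_homs[OF F fg(1)] is_functor_homs[OF F fg(2)] unfolding is_functor_def by blast
  ultimately show "fa G (fa F (cComp C g f)) = cComp E (fa G (fa F g)) (fa G (fa F f))" by simp
qed

text \<open>A functor that replaces objects and keeps the underlying maps. Forgetting a structure and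
  choosing one are both of this kind.\<close>

definition object_functor :: "('o \<Rightarrow> 'p) \<Rightarrow>
    ('o, 'o \<times> 'o \<times> ('m \<Rightarrow> 'm), 'p, 'p \<times> 'p \<times> ('m \<Rightarrow> 'm)) func" where
  "object_functor L = \<lparr>fo = L, fa = (\<lambda>(X, Y, f). (L X, L Y, f))\<rparr>"

lemma object_functor_simps:
  "fo (object_functor L) X = L X" "fa (object_functor L) (X, Y, f) = (L X, L Y, f)"
  by (simp_all add: object_functor_def)

lemma object_functor_id: "func_id = object_functor (\<lambda>X. X)"
  by (simp add: func_id_def object_functor_def fun_eq_iff)

lemma object_functor_comp:
  "func_comp (object_functor R) (object_functor L) = object_functor (\<lambda>X. R (L X))"
  by (auto simp: func_comp_def object_functor_def fun_eq_iff)

lemma is_functor_object_functor: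
  assumes "map_category P H T" "map_category P' H' T'"
    and "\<And>X. P X \<Longrightarrow> P' (L X)" "\<And>X. P X \<Longrightarrow> T' (L X) = T X"
    and "\<And>X Y f. P X \<Longrightarrow> P Y \<Longrightarrow> H X Y f \<Longrightarrow> H' (L X) (L Y) f"
  shows "is_functor (maps_cat P H T) (maps_cat P' H' T') (object_functor L)"
  unfolding is_functor_def
proof (intro conjI ballI allI impI)
  show "category (maps_cat P H T)" "category (maps_cat P' H' T')"
    by (fact map_category.is_category[OF assms(1)] map_category.is_category[OF assms(2)])+
next
  fix X assume "X \<in> Ob (maps_cat P H T)"
  then have "P X" by (simp add: maps_cat_simps)
  then show "fo (object_functor L) X \<in> Ob (maps_cat P' H' T')"
    "fa (object_functor L) (cId (maps_cat P H T) X) = cId (maps_cat P' H' T') (fo (object_functor L) X)"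
    using assms(3,4) by (simp_all add: maps_cat_simps object_functor_simps)
next
  fix X Y f assume "f \<in> homs (maps_cat P H T) X Y"
  then obtain h where "f = (X, Y, h)" "P X" "P Y" "H X Y h" by (auto simp: maps_cat_simps)
  then show "fa (object_functor L) f \<in>
      homs (maps_cat P' H' T') (fo (object_functor L) X) (fo (object_functor L) Y)"
    using assms(3,5) by (simp add: maps_cat_simps object_functor_simps)
next
  fix X Y Z f g assume "f \<in> homs (maps_cat P H T) X Y" "g \<in> homs (maps_cat P H T) Y Z"
  then obtain h h' where "f = (X, Y, h)" "g = (Y, Z, h')" "P X" by (auto simp: maps_cat_simps)
  then show "fa (object_functor L) (cComp (maps_cat P H T) g f) =
      cComp (maps_cat P' H' T') (fa (object_functor L) g) (fa (object_functor L) f)"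
    using assms(4) by (simp add: maps_cat_simps object_functor_simps)
qed

text \<open>The identity maps of underlying sets form a natural transformation as soon as they are
  admissible: both ways round the naturality square are the underlying map of the given arrow.\<close>

lemma nat_trans_object_functors:
  assumes D: "map_category P' H' T'"
    and F: "is_functor (maps_cat P H T) (maps_cat P' H' T') (object_functor F)"
    and G: "is_functor (maps_cat P H T) (maps_cat P' H' T') (object_functor G)"
    and t: "\<And>X. P X \<Longrightarrow> H' (F X) (G X) (\<lambda>x\<in>T' (F X). x)"
  shows "nat_trans (maps_cat P H T) (maps_cat P' H' T') (object_functor F) (object_functor G)
     (\<lambda>X. (F X, G X, \<lambda>x\<in>T' (F X). x))"
proof -
  have ob: "P' (F X)" "P' (G X)" if "P X" for X
    using F G that by (auto simp: is_functor_def maps_cat_simps object_functor_simps)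
  have ar: "H' (F X) (F Y) f" if "P X" "P Y" "H X Y f" for X Y f
  proof -
    have "(X, Y, f) \<in> homs (maps_cat P H T) X Y" using that by (simp add: maps_cat_simps)
    from is_functor_homs[OF F this] show ?thesis by (simp add: maps_cat_simps object_functor_simps)
  qed
  show ?thesis
    unfolding nat_trans_def
  proof (intro conjI ballI allI impI F G)
    fix X assume "X \<in> Ob (maps_cat P H T)"
    then show "(F X, G X, \<lambda>x\<in>T' (F X). x) \<in>
        homs (maps_cat P' H' T') (fo (object_functor F) X) (fo (object_functor G) X)"
      using ob t by (simp add: maps_cat_simps object_functor_simps)
  next
    fix X Y f assume "f \<in> homs (maps_cat P H T) X Y"
    then obtain h where f: "f = (X, Y, h)" and h: "P X" "P Y" "H X Y h"
      by (auto simp: maps_cat_simps)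
    interpret D: map_category P' H' T' by (rule D)
    have "P' (F X)" "P' (F Y)" "H' (F X) (F Y) h" using ob h ar by blast+
    note ident = D.compose_ident[OF this]
    show "cComp (maps_cat P' H' T') (fa (object_functor G) f) (F X, G X, \<lambda>x\<in>T' (F X). x) =
        cComp (maps_cat P' H' T') (F Y, G Y, \<lambda>x\<in>T' (F Y). x) (fa (object_functor F) f)"
      by (simp only: f object_functor_simps maps_cat_simps ident)
  qed
qed

lemma nat_isomorphic_object_functors:
  assumes D: "map_category P' H' T'"
    and F: "is_functor (maps_cat P H T) (maps_cat P' H' T') (object_functor F)"
    and G: "is_functor (maps_cat P H T) (maps_cat P' H' T') (object_functor G)"
    and T: "\<And>X. P X \<Longrightarrow> T' (F X) = T' (G X)"
    and t: "\<And>X. P X \<Longrightarrow> H' (F X) (G X) (\<lambda>x\<in>T' (F X). x)"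
      "\<And>X. P X \<Longrightarrow> H' (G X) (F X) (\<lambda>x\<in>T' (G X). x)"
  shows "nat_isomorphic (maps_cat P H T) (maps_cat P' H' T') (object_functor F) (object_functor G)"
  unfolding nat_isomorphic_def
proof (intro exI conjI ballI)
  show "nat_trans (maps_cat P H T) (maps_cat P' H' T') (object_functor F) (object_functor G)
     (\<lambda>X. (F X, G X, \<lambda>x\<in>T' (F X). x))"
    using D F G t(1) by (rule nat_trans_object_functors)
  fix X assume "X \<in> Ob (maps_cat P H T)"
  then have X: "P X" by (simp add: maps_cat_simps)
  have ob: "P' (F X)" "P' (G X)"
    using F G X by (auto simp: is_functor_def maps_cat_simps object_functor_simps)
  show "iso_arrow (maps_cat P' H' T') (F X, G X, \<lambda>x\<in>T' (F X). x)"
    unfolding iso_arrow_def maps_cat_simps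
  proof (intro conjI bexI[of _ "(G X, F X, \<lambda>x\<in>T' (G X). x)"] ob)
    show "H' (F X) (G X) (\<lambda>x\<in>T' (F X). x)" by (rule t(1)[OF X])
    show "(G X, F X, \<lambda>x\<in>T' (G X). x) \<in> homs (maps_cat P' H' T') (G X) (F X)"
      using ob t(2)[OF X] by (simp add: maps_cat_simps)
  qed (simp_all only: maps_cat_simps T[OF X] compose_restrict_id)
qed

text \<open>If the identity maps of underlying sets are admissible as unit and counit, the triangle
  identities hold because all maps in them are identity maps.\<close>

lemma adjunction_object_functors:
  assumes C: "map_category P H T" and D: "map_category P' H' T'"
    and L: "is_functor (maps_cat P H T) (maps_cat P' H' T') (object_functor L)"
    and R: "is_functor (maps_cat P' H' T') (maps_cat P H T) (object_functor R)"
    and T: "\<And>X. P X \<Longrightarrow> T' (L X) = T X" "\<And>Y. P' Y \<Longrightarrow> T (R Y) = T' Y"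
    and unit: "\<And>X. P X \<Longrightarrow> H X (R (L X)) (\<lambda>x\<in>T X. x)"
    and counit: "\<And>Y. P' Y \<Longrightarrow> H' (L (R Y)) Y (\<lambda>x\<in>T' (L (R Y)). x)"
  shows "adjunction (maps_cat P H T) (maps_cat P' H' T') (object_functor L) (object_functor R)"
proof -
  let ?C = "maps_cat P H T" and ?D = "maps_cat P' H' T'"
  have ob: "P' (L X)" if "P X" for X
    using L that by (auto simp: is_functor_def maps_cat_simps object_functor_simps)
  have ob': "P (R Y)" if "P' Y" for Y
    using R that by (auto simp: is_functor_def maps_cat_simps object_functor_simps)
  have id: "is_functor ?C ?C (object_functor (\<lambda>X. X))" "is_functor ?D ?D (object_functor (\<lambda>Y. Y))"
    using C D by (auto intro: is_functor_object_functor)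
  have comp: "is_functor ?C ?C (object_functor (\<lambda>X. R (L X)))" "is_functor ?D ?D (object_functor (\<lambda>Y. L (R Y)))"
    using is_functor_comp[OF L R] is_functor_comp[OF R L] by (simp_all add: object_functor_comp)
  have eta: "nat_trans ?C ?C func_id (func_comp (object_functor R) (object_functor L))
      (\<lambda>X. (X, R (L X), \<lambda>x\<in>T X. x))"
    unfolding object_functor_id object_functor_comp
    using C id(1) comp(1) unit by (rule nat_trans_object_functors)
  have eps: "nat_trans ?D ?D (func_comp (object_functor L) (object_functor R)) func_id
      (\<lambda>Y. (L (R Y), Y, \<lambda>x\<in>T' (L (R Y)). x))"
    unfolding object_functor_id object_functor_comp
    using D comp(2) id(2) counit by (rule nat_trans_object_functors)
  show ?thesis
    unfolding adjunction_def
  proof (intro conjI exI[of _ "\<lambda>X. (X, R (L X), \<lambda>x\<in>T X. x)"]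
      exI[of _ "\<lambda>Y. (L (R Y), Y, \<lambda>x\<in>T' (L (R Y)). x)"] L R eta eps ballI)
    fix X assume "X \<in> Ob ?C"
    then have "P X" by (simp add: maps_cat_simps)
    then show "cComp ?D (L (R (fo (object_functor L) X)), fo (object_functor L) X,
          \<lambda>x\<in>T' (L (R (fo (object_functor L) X))). x)
        (fa (object_functor L) (X, R (L X), \<lambda>x\<in>T X. x)) = cId ?D (fo (object_functor L) X)"
      by (simp add: maps_cat_simps object_functor_simps T ob ob' compose_restrict_id)
  next
    fix Y assume "Y \<in> Ob ?D"
    then have "P' Y" by (simp add: maps_cat_simps)
    then show "cComp ?C (fa (object_functor R) (L (R Y), Y, \<lambda>x\<in>T' (L (R Y)). x))
        (fo (object_functor R) Y, R (L (fo (object_functor R) Y)), \<lambda>x\<in>T (fo (object_functor R) Y). x) =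
        cId ?C (fo (object_functor R) Y)"
      by (simp add: maps_cat_simps object_functor_simps T ob ob' compose_restrict_id)
  qed
qed

section \<open>Absorption forces every map of class \<open>C\<^sup>k\<close> into the class\<close>

text \<open>The retraction of the identity map.\<close>

lemma B_diffeo_exists:
  assumes "retractible_diffeos n k \<B>" "U \<in> opens n"
  obtains h where "h \<in> B_diffeos n k \<B> U U"
proof -
  obtain r where "is_retraction n k \<B> U U r"
    using assms unfolding retractible_diffeos_def by blast
  then have "r (\<lambda>x\<in>U. x) \<in> B_diffeos n k \<B> U U"
    using id_in_Ck_diffeos[OF assms(2)] unfolding is_retraction_def by blast
  then show thesis by (rule that)
qed

lemma Ck_diffeo_inverse:
  assumes "h \<in> Ck_diffeos n k U U"
  defines "h' \<equiv> restrict (inv_into U h) U"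
  shows "h' \<in> Ck_maps n k U U" "x \<in> U \<Longrightarrow> h x \<in> U" "x \<in> U \<Longrightarrow> h' (h x) = x" "x \<in> U \<Longrightarrow> h (h' x) = x"
proof -
  have bij: "bij_betw h U U" and "h' \<in> Ck_maps n k U U"
    using assms by (auto simp: Ck_diffeos_def)
  then show "h' \<in> Ck_maps n k U U" by simp
  show hx: "h x \<in> U" if "x \<in> U" for x using bij that by (auto simp: bij_betw_def)
  show "h' (h x) = x" if "x \<in> U"
    using bij hx[OF that] that by (simp add: h'_def bij_betw_inv_into_left)
  show "h (h' x) = x" if "x \<in> U"
    using bij that by (simp add: h'_def bij_betw_inv_into_right)
qed

text \<open>With a diffeomorphism \<open>h\<close> of \<open>U\<close> in the class, \<open>g = (g \<circ> h\<^sup>-\<^sup>1) \<circ> h\<close> has the form that left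
  absorption admits.\<close>

lemma left_absorbing_CkM:
  assumes "fully_left_absorbing n k \<B>" "retractible_diffeos n k \<B>" "U \<in> opens n"
  shows "CkM n k U \<subseteq> \<B> U"
proof
  fix g assume g: "g \<in> CkM n k U"
  obtain h where h: "h \<in> B_diffeos n k \<B> U U" using B_diffeo_exists[OF assms(2,3)] .
  then have "h \<in> Ck_diffeos n k U U" by (simp add: B_diffeos_def)
  note inv = Ck_diffeo_inverse[OF this]
  define h' where "h' = restrict (inv_into U h) U"
  have "g \<in> Ck_maps n k U (Rn n)" using g by (simp add: Ck_maps_def CkM_def)
  then have "compose U g h' \<in> Ck_maps n k U (Rn n)"
    unfolding h'_def by (rule Ck_maps_compose[OF assms(3,3) inv(1)])
  then have "compose U (compose U g h') h \<in> B_maps \<B> U (Rn n)"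
    using assms(1,3) h Rn_in_opens unfolding fully_left_absorbing_def by blast
  moreover have "compose U (compose U g h') h = g"
  proof (rule extensionalityI[of _ U])
    show "g \<in> extensional U" using g by (simp add: CkM_def)
    show "compose U (compose U g h') h x = g x" if "x \<in> U" for x
      using inv(2,3)[OF that] that by (simp add: compose_eq h'_def)
  qed simp
  ultimately show "g \<in> \<B> U" by (simp add: B_maps_def)
qed

text \<open>With a diffeomorphism \<open>h\<close> of the target \<open>\<real>\<^sup>n\<close> in the class, \<open>f = h \<circ> (h\<^sup>-\<^sup>1 \<circ> f)\<close> has the form
  that right absorption admits.\<close>

lemma right_absorbing_CkM:
  assumes "fully_right_absorbing n k \<B>" "retractible_diffeos n k \<B>" "U \<in> opens n"
  shows "CkM n k U \<subseteq> \<B> U"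
proof
  fix f assume f: "f \<in> CkM n k U"
  obtain h where h: "h \<in> B_diffeos n k \<B> (Rn n) (Rn n)"
    using B_diffeo_exists[OF assms(2) Rn_in_opens] .
  then have "h \<in> Ck_diffeos n k (Rn n) (Rn n)" by (simp add: B_diffeos_def)
  note inv = Ck_diffeo_inverse[OF this]
  define h' where "h' = restrict (inv_into (Rn n) h) (Rn n)"
  have fR: "f \<in> Ck_maps n k U (Rn n)" using f by (simp add: Ck_maps_def CkM_def)
  then have "compose U h' f \<in> Ck_maps n k U (Rn n)"
    unfolding h'_def using inv(1) by (rule Ck_maps_compose[OF assms(3) Rn_in_opens])
  then have "compose U h (compose U h' f) \<in> B_maps \<B> U (Rn n)"
    using assms(1,3) h Rn_in_opens unfolding fully_right_absorbing_def by blast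
  moreover have "compose U h (compose U h' f) = f"
  proof (rule extensionalityI[of _ U])
    show "f \<in> extensional U" using f by (simp add: CkM_def)
    fix x assume x: "x \<in> U"
    then have "f x \<in> Rn n" using f by (auto simp: CkM_def)
    then show "compose U h (compose U h' f) x = f x"
      using inv(4)[of "f x"] x by (simp add: compose_eq h'_def)
  qed simp
  ultimately show "f \<in> \<B> U" by (simp add: B_maps_def)
qed

lemma retraction_fixes_Ck_diffeos:
  assumes "retraction_presheaf n k \<B> r" "U \<in> opens n" "V \<in> opens n" "\<B> U = CkM n k U"
    and "f \<in> Ck_diffeos n k U V"
  shows "r U V f = f"
proof -
  have "f \<in> B_diffeos n k \<B> U V"
    using assms(4,5) by (auto simp: B_diffeos_def B_maps_def Ck_diffeos_def Ck_maps_def)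
  then show ?thesis
    using assms(1-3) by (simp add: retraction_presheaf_def is_retraction_def)
qed

lemma retraction_presheaf_exists:
  assumes "retractible_diffeos n k \<B>"
  obtains r where "retraction_presheaf n k \<B> r"
proof -
  define r where "r U V = (SOME s. is_retraction n k \<B> U V s)" for U V
  have "is_retraction n k \<B> U V (r U V)" if "U \<in> opens n" "V \<in> opens n" for U V
    using someI_ex[of "is_retraction n k \<B> U V"] assms that
    unfolding r_def retractible_diffeos_def by blast
  then have "retraction_presheaf n k \<B> r" by (simp add: retraction_presheaf_def)
  then show thesis by (rule that)
qed

section \<open>Manifolds structured by all maps of class \<open>C\<^sup>k\<close>\<close>

text \<open>The transition maps of a subatlas are of class \<open>C\<^sup>k\<close> anyway, so a structure is just a subatlas
  that covers the manifold.\<close>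

lemma B_manifold_iff:
  assumes "\<forall>U\<in>opens n. \<B> U = CkM n k U"
  shows "B_manifold n k \<B> N \<longleftrightarrow> Ck_manifold n k (fst N) \<and> snd N \<subseteq> snd (fst N) \<and>
    \<Union>(fst ` snd N) = topspace (fst (fst N))"
proof -
  have "transition c c' \<in> \<B> (trans_dom c c')"
    if "Ck_manifold n k (fst N)" "c \<in> snd (fst N)" "c' \<in> snd (fst N)" for c c'
  proof -
    have "trans_dom c c' \<in> opens n"
      using Ck_manifoldD(1)[OF that(1,2)] Ck_manifoldD(1)[OF that(1,3)] by (rule trans_dom_open)
    then show ?thesis using Ck_manifoldD(3)[OF that] assms by simp
  qed
  then show ?thesis unfolding B_manifold_def B_structure_def by blast
qed

lemma B_mfd_map_iff:
  assumes "\<forall>U\<in>opens n. \<B> U = CkM n k U" "B_manifold n k \<B> N" "B_manifold n k \<B> N'"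
  shows "B_mfd_map n k \<B> N N' f \<longleftrightarrow> Ck_mfd_map n k (fst N) (fst N') f"
proof -
  have "local_rep c f c' \<in> \<B> (rep_dom c f c')"
    if f: "Ck_mfd_map n k (fst N) (fst N') f" and c: "c \<in> snd N" "c' \<in> snd N'" for c c'
  proof -
    have X: "Ck_manifold n k (fst N)" "Ck_manifold n k (fst N')"
      and c: "c \<in> snd (fst N)" "c' \<in> snd (fst N')"
      using assms(2,3) c by (auto simp: B_manifold_iff[OF assms(1)])
    have "rep_dom c f c' \<in> opens n"
      using Ck_manifoldD(1)[OF X(1) c(1)] is_chartD(1)[OF Ck_manifoldD(1)[OF X(2) c(2)]]
        f[unfolded Ck_mfd_map_def] by (intro rep_dom_open) auto
    then show ?thesis using f c assms(1) by (simp add: Ck_mfd_map_def)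
  qed
  then show ?thesis unfolding B_mfd_map_def by blast
qed

lemma B_manifold_imp_Ck_manifold: "B_manifold n k \<B> N \<Longrightarrow> Ck_manifold n k (fst N)"
  by (simp add: B_manifold_def)

text \<open>The retraction fixes the transition map \<open>\<psi> \<circ> \<phi>\<^sup>-\<^sup>1\<close>, so the induced chart
  \<open>r (\<psi> \<circ> \<phi>\<^sup>-\<^sup>1) \<circ> \<phi>\<close> is the restriction of \<open>\<psi>\<close> to the overlap.\<close>

lemma induced_structure_subset_atlas:
  assumes "\<forall>U\<in>opens n. \<B> U = CkM n k U" "retraction_presheaf n k \<B> r"
    and X: "Ck_manifold n k X"
  shows "induced_structure r X \<subseteq> snd X"
proof
  fix d assume "d \<in> induced_structure r X"
  then obtain c c' where c: "c \<in> snd X" "c' \<in> snd X" and d: "d = induced_chart r c c'"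
    by (auto simp: induced_structure_def)
  note chart = Ck_manifoldD(1)[OF X c(1)] Ck_manifoldD(1)[OF X c(2)]
  let ?I = "fst c \<inter> fst c'"
  have r: "r (trans_dom c c') (trans_dom c' c) (transition c c') = transition c c'"
  proof (rule retraction_fixes_Ck_diffeos[OF assms(2) _ _ _ transition_in_Ck_diffeos[OF X c]])
    show dom: "trans_dom c c' \<in> opens n" using chart by (rule trans_dom_open)
    show "trans_dom c' c \<in> opens n" using chart(2,1) by (rule trans_dom_open)
    show "\<B> (trans_dom c c') = CkM n k (trans_dom c c')" using dom assms(1) by blast
  qed
  have "compose ?I (transition c c') (snd c) = restrict (snd c') ?I"
  proof (rule extensionalityI[of _ ?I])
    fix x assume "x \<in> ?I"
    then show "compose ?I (transition c c') (snd c) x = restrict (snd c') ?I x"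
      using local_rep_apply[of c x "\<lambda>x. x" c'] is_chartD(4)[OF chart(1)] by (simp add: compose_eq)
  qed simp_all
  then have "d = restrict_chart c' ?I" by (simp add: d induced_chart_def r restrict_chart_def)
  moreover have "openin (fst X) ?I" using is_chartD(1)[OF chart(1)] is_chartD(1)[OF chart(2)] by (rule openin_Int)
  ultimately show "d \<in> snd X" using restrict_chart_in_atlas[OF X c(2)] by simp
qed

text \<open>The induced charts cover because those of a pair of equal charts \<open>c, c\<close> live on all of the domain
  of \<open>c\<close>.\<close>

lemma B_manifold_induced:
  assumes "\<forall>U\<in>opens n. \<B> U = CkM n k U" "retraction_presheaf n k \<B> r"
    and "Ck_manifold n k X"
  shows "B_manifold n k \<B> (X, induced_structure r X)"
proof -
  note sub = induced_structure_subset_atlas[OF assms]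
  have "fst c \<in> fst ` induced_structure r X" if "c \<in> snd X" for c
  proof
    show "induced_chart r c c \<in> induced_structure r X"
      unfolding induced_structure_def using that by blast
  qed (simp add: induced_chart_def)
  then have "\<Union>(fst ` induced_structure r X) = topspace (fst X)"
    unfolding Ck_manifoldD(2)[OF assms(3), symmetric]
    by (intro antisym Union_mono image_mono[OF sub]) (rule image_subsetI)
  then show ?thesis using sub assms(3) by (simp add: B_manifold_iff[OF assms(1)])
qed

lemma B_mfd_map_category:
  assumes B: "\<forall>U\<in>opens n. \<B> U = CkM n k U"
  shows "map_category (B_manifold n k \<B>) (B_mfd_map n k \<B>) (\<lambda>N. topspace (fst (fst N)))"
proof
  fix N N' N'' :: "'a bmfd" and f g
  assume N: "B_manifold n k \<B> N" and N': "B_manifold n k \<B> N'"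
  note Ck = B_manifold_imp_Ck_manifold
  show "B_mfd_map n k \<B> N N (\<lambda>x\<in>topspace (fst (fst N)). x)"
    using Ck_mfd_map_id[OF Ck[OF N]] unfolding B_mfd_map_iff[OF B N N] .
  assume f: "B_mfd_map n k \<B> N N' f"
  then have f': "Ck_mfd_map n k (fst N) (fst N') f" by (simp add: B_mfd_map_def)
  show "f \<in> extensional (topspace (fst (fst N)))" "f \<in> topspace (fst (fst N)) \<rightarrow> topspace (fst (fst N'))"
    using Ck_mfd_map_extensional[OF f'] Ck_mfd_map_funcset[OF f'] by simp_all
  assume N'': "B_manifold n k \<B> N''" and "B_mfd_map n k \<B> N' N'' g"
  then have g': "Ck_mfd_map n k (fst N') (fst N'') g" by (simp add: B_mfd_map_def)
  show "B_mfd_map n k \<B> N N'' (compose (topspace (fst (fst N))) g f)"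
    using Ck_mfd_map_compose[OF Ck[OF N] Ck[OF N'] Ck[OF N''] f' g']
    unfolding B_mfd_map_iff[OF B N N''] .
qed

lemma Ck_mfd_map_category:
  "map_category (Ck_manifold n k) (Ck_mfd_map n k) (\<lambda>X. topspace (fst X))"
  using Ck_mfd_map_extensional Ck_mfd_map_funcset Ck_mfd_map_id Ck_mfd_map_compose
  by (rule map_category.intro)

section \<open>Adjunctions whose unit and counit are identity maps\<close>

lemma forget_eq_object_functor: "forget = object_functor fst"
  by (simp add: forget_def object_functor_def)

lemma induced_functor_eq_object_functor:
  "induced_functor r = object_functor (\<lambda>X. (X, induced_structure r X))"
  by (simp add: induced_functor_def object_functor_def)

lemma Diff_cat_eq_maps_cat:
  "Diff_cat n k = maps_cat (Ck_manifold n k) (Ck_mfd_map n k) (\<lambda>X. topspace (fst X))"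
  by (simp add: Diff_cat_def maps_cat_def)

lemma BDiff_cat_eq_maps_cat:
  "BDiff_cat n k \<B> = maps_cat (B_manifold n k \<B>) (B_mfd_map n k \<B>) (\<lambda>N. topspace (fst (fst N)))"
  by (simp add: BDiff_cat_def maps_cat_def)

lemma is_functor_forget:
  assumes "\<forall>U\<in>opens n. \<B> U = CkM n k U"
  shows "is_functor (maps_cat (B_manifold n k \<B>) (B_mfd_map n k \<B>) (\<lambda>N. topspace (fst (fst N))))
    (maps_cat (Ck_manifold n k) (Ck_mfd_map n k) (\<lambda>X. topspace (fst X))) (object_functor fst)"
  by (rule is_functor_object_functor[OF B_mfd_map_category[OF assms] Ck_mfd_map_category])
     (simp_all add: B_manifold_def B_mfd_map_def)

lemma is_functor_induced:
  assumes B: "\<forall>U\<in>opens n. \<B> U = CkM n k U" and r: "retraction_presheaf n k \<B> r"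
  shows "is_functor (maps_cat (Ck_manifold n k) (Ck_mfd_map n k) (\<lambda>X. topspace (fst X)))
    (maps_cat (B_manifold n k \<B>) (B_mfd_map n k \<B>) (\<lambda>N. topspace (fst (fst N))))
    (object_functor (\<lambda>X. (X, induced_structure r X)))"
proof (rule is_functor_object_functor[OF Ck_mfd_map_category B_mfd_map_category[OF B]])
  fix X Y :: "'a mfd" and f
  assume X: "Ck_manifold n k X" and Y: "Ck_manifold n k Y" and f: "Ck_mfd_map n k X Y f"
  show "B_mfd_map n k \<B> (X, induced_structure r X) (Y, induced_structure r Y) f"
    using f B_mfd_map_iff[OF B B_manifold_induced[OF B r X] B_manifold_induced[OF B r Y]] by simp
qed (simp_all add: B_manifold_induced[OF B r])

text \<open>Two structures on the same \<open>C\<^sup>k\<close>-manifold are compatible. These arrows serve as unit, counit and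
  comparison isomorphisms.\<close>

lemma B_mfd_map_ident:
  assumes "\<forall>U\<in>opens n. \<B> U = CkM n k U"
    and "B_manifold n k \<B> N" "B_manifold n k \<B> N'" "fst N = fst N'"
  shows "B_mfd_map n k \<B> N N' (\<lambda>x\<in>topspace (fst (fst N)). x)"
  using Ck_mfd_map_id[OF B_manifold_imp_Ck_manifold[OF assms(3)]] B_mfd_map_iff[OF assms(1-3)] assms(4)
  by simp

lemma induced_functors_isomorphic:
  assumes B: "\<forall>U\<in>opens n. \<B> U = CkM n k U"
    and r: "retraction_presheaf n k \<B> r" "retraction_presheaf n k \<B> r'"
  shows "nat_isomorphic (Diff_cat n k) (BDiff_cat n k \<B>) (induced_functor r) (induced_functor r')"
  unfolding Diff_cat_eq_maps_cat BDiff_cat_eq_maps_cat induced_functor_eq_object_functor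
proof (rule nat_isomorphic_object_functors[OF B_mfd_map_category[OF B],
      OF is_functor_induced[OF B r(1)] is_functor_induced[OF B r(2)]])
  fix X :: "'a mfd" assume X: "Ck_manifold n k X"
  note ind = B_manifold_induced[OF B r(1) X] B_manifold_induced[OF B r(2) X]
  show "B_mfd_map n k \<B> (X, induced_structure r X) (X, induced_structure r' X)
      (\<lambda>x\<in>topspace (fst (fst (X, induced_structure r X))). x)"
    by (rule B_mfd_map_ident[OF B ind]) simp_all
  show "B_mfd_map n k \<B> (X, induced_structure r' X) (X, induced_structure r X)
      (\<lambda>x\<in>topspace (fst (fst (X, induced_structure r' X))). x)"
    by (rule B_mfd_map_ident[OF B ind(2,1)]) simp_all
qed simp_all

lemma induced_functor_adjoint_forget:
  assumes B: "\<forall>U\<in>opens n. \<B> U = CkM n k U" and r: "retraction_presheaf n k \<B> r"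
  shows "adjunction (Diff_cat n k) (BDiff_cat n k \<B> :: ('m bmfd, _) cat) (induced_functor r) forget"
    and "adjunction (BDiff_cat n k \<B> :: ('m bmfd, _) cat) (Diff_cat n k) forget (induced_functor r)"
proof -
  note C = Ck_mfd_map_category and D = B_mfd_map_category[OF B]
  note L = is_functor_induced[OF B r] and F = is_functor_forget[OF B]
  have ind: "B_manifold n k \<B> (fst N, induced_structure r (fst N))"
    if "B_manifold n k \<B> N" for N :: "'m bmfd"
    by (rule B_manifold_induced[OF B r B_manifold_imp_Ck_manifold[OF that]])
  show "adjunction (Diff_cat n k) (BDiff_cat n k \<B> :: ('m bmfd, _) cat) (induced_functor r) forget"
    unfolding Diff_cat_eq_maps_cat BDiff_cat_eq_maps_cat induced_functor_eq_object_functor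
      forget_eq_object_functor
  proof (rule adjunction_object_functors[OF C D, OF L F])
    fix N :: "'m bmfd" assume N: "B_manifold n k \<B> N"
    show "B_mfd_map n k \<B> (fst N, induced_structure r (fst N)) N
        (\<lambda>x\<in>topspace (fst (fst (fst N, induced_structure r (fst N)))). x)"
      using B ind[OF N] N by (rule B_mfd_map_ident) (rule fst_conv)
  qed (simp_all add: Ck_mfd_map_id)
  show "adjunction (BDiff_cat n k \<B> :: ('m bmfd, _) cat) (Diff_cat n k) forget (induced_functor r)"
    unfolding Diff_cat_eq_maps_cat BDiff_cat_eq_maps_cat induced_functor_eq_object_functor
      forget_eq_object_functor
  proof (rule adjunction_object_functors[OF D C, OF F L])
    fix N :: "'m bmfd" assume N: "B_manifold n k \<B> N"
    show "B_mfd_map n k \<B> N (fst N, induced_structure r (fst N)) (\<lambda>x\<in>topspace (fst (fst N)). x)"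
      using B N ind[OF N] by (rule B_mfd_map_ident) (rule fst_conv[symmetric])
  qed (simp_all add: Ck_mfd_map_id)
qed

theorem theoremB:
  fixes n :: nat and k :: enat and \<Gamma> :: "real set" and \<Lambda> :: "nat set"
    and \<alpha> \<beta> :: "nat \<Rightarrow> nat"
    and S :: "fn vs set" and B :: dpsh and \<X> :: "('xo, 'xa) isp"
    and D :: "nat lpsh" and u u' :: "pt set \<Rightarrow> (nat, fn) larr"
    and \<B> :: fclass
    and Diff :: "('m mfd, 'm mfd \<times> 'm mfd \<times> ('m \<Rightarrow> 'm)) cat"
    and BDiff :: "('m bmfd, 'm bmfd \<times> 'm bmfd \<times> ('m \<Rightarrow> 'm)) cat"
  assumes "\<Lambda> = {i. real i \<in> \<Gamma>}" and "\<Lambda> \<noteq> {}"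
    and "\<alpha> \<in> \<Lambda> \<rightarrow> \<Lambda>" and "\<forall>i\<in>\<Lambda>. enat (\<beta> i) \<le> k"
    and "space_class n k \<Lambda> \<beta> S"
    and "is_dpsh n S \<Lambda> B"
    and "full_isp n k S \<Lambda> \<alpha> \<beta> B \<X>"
    and "proper_isp n k S \<Lambda> \<alpha> \<beta> B \<X> D u u'"
    and "C_presheaf n k S \<Lambda> \<alpha> \<beta> B \<X> D u'"
    and "ordered_in n k S \<Lambda> \<alpha> \<beta> B \<X> D"
    and "\<B> = B_fun n k \<Lambda> D u'"
    and "retractible_diffeos n k \<B>"
    and "Diff = Diff_cat n k" and "BDiff = BDiff_cat n k \<B>"
  shows "(fully_left_absorbing n k \<B> \<longrightarrow>
            (\<forall>r. retraction_presheaf n k \<B> r \<longrightarrow> adjunction Diff BDiff (induced_functor r) forget) \<and>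
            (\<forall>r r'. retraction_presheaf n k \<B> r \<longrightarrow> retraction_presheaf n k \<B> r' \<longrightarrow>
               nat_isomorphic Diff BDiff (induced_functor r) (induced_functor r')))
       \<and> (fully_right_absorbing n k \<B> \<longrightarrow>
            (\<forall>r. retraction_presheaf n k \<B> r \<longrightarrow> adjunction BDiff Diff forget (induced_functor r)) \<and>
            (\<forall>r r'. retraction_presheaf n k \<B> r \<longrightarrow> retraction_presheaf n k \<B> r' \<longrightarrow>
               nat_isomorphic Diff BDiff (induced_functor r) (induced_functor r')))
       \<and> (fully_absorbing n k \<B> \<longrightarrow> ambidextrous_adjoint BDiff Diff forget)"
proof -
  have B: "\<forall>U\<in>opens n. \<B> U = CkM n k U"
    if "fully_left_absorbing n k \<B> \<or> fully_right_absorbing n k \<B>"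
  proof
    fix U assume U: "U \<in> opens n"
    show "\<B> U = CkM n k U"
    proof
      show "\<B> U \<subseteq> CkM n k U"
        unfolding \<open>\<B> = B_fun n k \<Lambda> D u'\<close> B_fun_def by (rule Collect_restrict)
      show "CkM n k U \<subseteq> \<B> U"
        using that left_absorbing_CkM[OF _ \<open>retractible_diffeos n k \<B>\<close> U]
          right_absorbing_CkM[OF _ \<open>retractible_diffeos n k \<B>\<close> U] by (rule disjE)
    qed
  qed
  note eqs = \<open>Diff = Diff_cat n k\<close> \<open>BDiff = BDiff_cat n k \<B>\<close>
  show ?thesis
  proof (intro conjI impI allI)
    fix r r' assume "fully_left_absorbing n k \<B>"
    then have B: "\<forall>U\<in>opens n. \<B> U = CkM n k U" by (intro B disjI1)
    assume r: "retraction_presheaf n k \<B> r"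
    show "adjunction Diff BDiff (induced_functor r) forget"
      unfolding eqs using B r by (rule induced_functor_adjoint_forget)
    assume r': "retraction_presheaf n k \<B> r'"
    show "nat_isomorphic Diff BDiff (induced_functor r) (induced_functor r')"
      unfolding eqs using B r r' by (rule induced_functors_isomorphic)
  next
    fix r r' assume "fully_right_absorbing n k \<B>"
    then have B: "\<forall>U\<in>opens n. \<B> U = CkM n k U" by (intro B disjI2)
    assume r: "retraction_presheaf n k \<B> r"
    show "adjunction BDiff Diff forget (induced_functor r)"
      unfolding eqs using B r by (rule induced_functor_adjoint_forget)
    assume r': "retraction_presheaf n k \<B> r'"
    show "nat_isomorphic Diff BDiff (induced_functor r) (induced_functor r')"
      unfolding eqs using B r r' by (rule induced_functors_isomorphic)
  next
    assume "fully_absorbing n k \<B>"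
    then have B: "\<forall>U\<in>opens n. \<B> U = CkM n k U" by (intro B disjI1) (simp add: fully_absorbing_def)
    obtain r where r: "retraction_presheaf n k \<B> r"
      using retraction_presheaf_exists[OF \<open>retractible_diffeos n k \<B>\<close>] .
    show "ambidextrous_adjoint BDiff Diff forget"
      unfolding ambidextrous_adjoint_def eqs
      using induced_functor_adjoint_forget[OF B r] by (intro exI conjI)
  qed
qed

end
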